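(* Let $i,j$ be real numbers with $i,j>0$ and $i+j=1$, let $\mathcal{D}=\{n_k\}_{k=0}^\infty$ be a $\mathcal{D}$-adic sequence with bounded ratios, and let $s\in(i,1]$. Let $\psi:\mathbb{N}\to\mathbb{R}_{\ge 0}$ be a function with $\psi(q)\to0$ as $q\to\infty$ such that the function $f_\psi:\mathbb{N}\to\mathbb{R}_{\ge0}$, $f_\psi(r)=r^{1-s}\psi^{i+js}(r)$, is decreasing. Then \[ \mathcal{H}^s\big(W_{\mathcal{D}}(i,j,\psi)\big)=\begin{cases}0, & \text{if } \sum_{r\in\mathbb{N}}f_\psi(r)<\infty,\\ \mathcal{H}^s([0,1)), & \text{if } \sum_{r\in\mathbb{N}}f_\psi(r)=\infty \text{ and } \psi \text{ is monotonic}.\end{cases} \]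
   Context: $\mathcal{H}^s$ denotes $s$-dimensional Hausdorff measure. A $\mathcal{D}$-adic sequence is a strictly increasing sequence $\mathcal{D}=\{n_k\}_{k\ge 0}$ of positive integers with $n_0=1$ and $n_k\mid n_{k+1}$ for all $k$; it has bounded ratios if $n_{k+1}/n_k$ is bounded by a constant independent of $k$. For $q\in\mathbb{N}$, $|q|_{\mathcal{D}}=\inf\{1/n_m: n_m\mid q\}$. For real $y$, $\|y\|$ is the distance from $y$ to the nearest integer. $W_{\mathcal{D}}(i,j,\psi)$ is the set of $x\in[0,1)$ such that $\max\{|q|_{\mathcal{D}}^{1/i},\|qx\|^{1/j}\}\le\psi(q)$ for infinitely many $q\in\mathbb{N}$. *)

theory Defs
  imports "HOL-Analysis.Analysis"
begin

text \<open>
  Hausdorff (outer) measure on a metric space, normalised by \<open>diameter ^ s\<close>. The boundedness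
  condition on covering sets is needed because \<^const>\<open>diameter\<close> is a real-valued supremum.
  The case split fixes the conventions \<open>0\<^sup>0 = 1\<close> for nonempty sets (HOL has \<open>0 powr 0 = 0\<close>)
  and cost \<open>0\<close> for the empty set.
\<close>

definition hausdorff_cost :: "real \<Rightarrow> 'a::metric_space set \<Rightarrow> ennreal" where
  "hausdorff_cost s U = (if U = {} then 0 else if s = 0 then 1 else ennreal (diameter U powr s))"

definition hausdorff_premeasure :: "real \<Rightarrow> real \<Rightarrow> 'a::metric_space set \<Rightarrow> ennreal" where
  "hausdorff_premeasure s \<delta> A =
     (INF U \<in> {U :: nat \<Rightarrow> 'a set. A \<subseteq> (\<Union>k. U k) \<and> (\<forall>k. bounded (U k) \<and> diameter (U k) \<le> \<delta>)}.
        \<Sum>k. hausdorff_cost s (U k))"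

definition hausdorff_measure :: "real \<Rightarrow> 'a::metric_space set \<Rightarrow> ennreal" where
  "hausdorff_measure s A = (SUP \<delta> \<in> {0<..}. hausdorff_premeasure s \<delta> A)"

definition adic_sequence :: "(nat \<Rightarrow> nat) \<Rightarrow> bool" where
  "adic_sequence D \<longleftrightarrow> strict_mono D \<and> D 0 = 1 \<and> (\<forall>k. D k dvd D (Suc k))"

definition bounded_ratios :: "(nat \<Rightarrow> nat) \<Rightarrow> bool" where
  "bounded_ratios D \<longleftrightarrow> (\<exists>C::real. \<forall>k. real (D (Suc k)) / real (D k) \<le> C)"

definition adic_abs :: "(nat \<Rightarrow> nat) \<Rightarrow> nat \<Rightarrow> real" where
  "adic_abs D q = Inf {1 / real (D m) | m. D m dvd q}"

definition dist_nearest_int :: "real \<Rightarrow> real" where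
  "dist_nearest_int y = \<bar>y - of_int (round y)\<bar>"

definition W_adic :: "(nat \<Rightarrow> nat) \<Rightarrow> real \<Rightarrow> real \<Rightarrow> (nat \<Rightarrow> real) \<Rightarrow> real set" where
  "W_adic D i j \<psi> =
     {x \<in> {0..<1}. infinite {q::nat. q \<ge> 1 \<and>
        max (adic_abs D q powr (1 / i)) (dist_nearest_int (real q * x) powr (1 / j)) \<le> \<psi> q}}"

definition f_psi :: "real \<Rightarrow> real \<Rightarrow> real \<Rightarrow> (nat \<Rightarrow> real) \<Rightarrow> nat \<Rightarrow> real" where
  "f_psi i j s \<psi> r = real r powr (1 - s) * \<psi> r powr (i + j * s)"

end

theory Submission
  imports Defs
begin

text \<open>
  Since \<open>\<psi>(r)\<^bsup>i+js\<^esup> = r\<^bsup>s-1\<^esup> f\<^sub>\<psi>(r)\<close>, the function \<open>\<psi>\<close> is always decreasing. If the series converges,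
  then among the \<open>q \<in> [2\<^sup>t, 2\<^bsup>t+1\<^esup>)\<close> at most \<open>2\<^bsup>t+1\<^esup> \<psi>(2\<^sup>t)\<^sup>i\<close> satisfy \<open>|q|\<^sub>D \<le> \<psi>(q)\<^sup>i\<close>, and the obvious
  cover by intervals of radius \<open>\<psi>(q)\<^sup>j / q\<close> has total cost comparable to the condensed series
  \<open>\<Sum> 2\<^sup>t f\<^sub>\<psi>(2\<^sup>t)\<close>.

  If the series diverges, let \<open>n\<^sub>t\<close> be the least term of the adic sequence with
  \<open>n\<^sub>t \<ge> \<psi>(2\<^sup>t)\<^bsup>-i\<^esup>\<close> and consider the rationals with denominators \<open>n\<^sub>t r \<le> 2\<^sup>t\<close>. Dirichlet's theorem shows
  that they are equidistributed at density \<open>N\<^sub>t = n\<^sub>t (2\<^sup>t div n\<^sub>t)\<^sup>2\<close>, and a second moment bound shows that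
  the intervals of radius \<open>(\<psi>(2\<^sup>t)\<^sup>j / 2\<^sup>t)\<^sup>s\<close> around them occupy a fixed proportion of every interval;
  hence their upper limit set has full Lebesgue measure. For \<open>s = 1\<close> this is the claim.
  For \<open>s < 1\<close> the radii are shrunk to \<open>\<psi>(2\<^sup>t)\<^sup>j / 2\<^sup>t\<close> by a mass transference argument: given a cover of
  finite cost, one builds nested shrunken intervals such that the covering sets meeting the
  current interval \<open>B\<close> have cost at most a small multiple of \<open>|B|\<^sup>s\<close>. The common point belongs to the
  upper limit set and is not covered.
\<close>

section \<open>Counting rationals with restricted denominators\<close>

text \<open>Two reals with the same floor differ by less than 1, so distinct points have distinct
  values \<open>\<lfloor>(p - x) * N\<rfloor>\<close>; these are integers between 0 and
  \<open>\<lfloor>l * N\<rfloor>\<close>.\<close>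

lemma card_spaced_le:
  fixes X :: "real set" and N :: real
  assumes X: "X \<subseteq> {x..x + l}" and N: "0 \<le> N" and l: "0 \<le> l"
    and sep: "\<And>p q. p \<in> X \<Longrightarrow> q \<in> X \<Longrightarrow> p \<noteq> q \<Longrightarrow> 1 \<le> N * \<bar>p - q\<bar>"
  shows "finite X" and "real (card X) \<le> 1 + l * N"
proof -
  let ?h = "\<lambda>p. \<lfloor>(p - x) * N\<rfloor>"
  have inj: "inj_on ?h X"
  proof (rule inj_onI, rule ccontr)
    fix p q assume *: "p \<in> X" "q \<in> X" "?h p = ?h q" "p \<noteq> q"
    then have "\<bar>(p - x) * N - (q - x) * N\<bar> < 1"
      by linarith
    then have "\<bar>p - q\<bar> * N < 1"
      using N by (simp add: abs_mult flip: left_diff_distrib)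
    then show False
      using sep[OF *(1,2,4)] by (simp add: mult.commute)
  qed
  have "?h ` X \<subseteq> {0..\<lfloor>l * N\<rfloor>}"
  proof
    fix y assume "y \<in> ?h ` X"
    then obtain p where p: "p \<in> X" "y = ?h p" by auto
    then have "x \<le> p" "p \<le> x + l" using X by auto
    then have "0 \<le> (p - x) * N" "(p - x) * N \<le> l * N"
      using N by (auto intro: mult_right_mono)
    then show "y \<in> {0..\<lfloor>l * N\<rfloor>}" using p by (auto intro: floor_mono)
  qed
  then show "finite X"
    using inj by (meson finite_atLeastAtMost_int finite_imageD finite_subset)
  have "card X = card (?h ` X)"
    using inj by (simp add: card_image)
  also have "\<dots> \<le> card {0..\<lfloor>l * N\<rfloor>}"
    by (rule card_mono) (use \<open>?h ` X \<subseteq> _\<close> in auto)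
  finally have "card X \<le> nat (\<lfloor>l * N\<rfloor> + 1)" by simp
  moreover have "0 \<le> l * N" using N l by simp
  ultimately have "int (card X) \<le> \<lfloor>l * N\<rfloor> + 1" by (simp add: le_nat_iff)
  then show "real (card X) \<le> 1 + l * N" by linarith
qed

text \<open>Fractions need not be in lowest terms, and equal fractions with different
  \<open>r\<close> are one point, so cardinalities count distinct rationals.\<close>

definition farey_points :: "nat \<Rightarrow> nat \<Rightarrow> real set" where
  "farey_points n R = {of_int h / (real n * real r) | h r. 1 \<le> r \<and> r \<le> R}"

text \<open>Both denominators contain the factor \<open>n\<close>, so a nonzero difference is at
  least \<open>1 / (n * r * t)\<close>. The common factor enters only once, hence
  \<open>n * R\<^sup>2\<close> and not \<open>n\<^sup>2 * R\<^sup>2\<close>.\<close>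

lemma farey_points_separated:
  assumes n: "0 < n" and "p \<in> farey_points n R" "q \<in> farey_points n R" "p \<noteq> q"
  shows "1 \<le> real (n * R\<^sup>2) * \<bar>p - q\<bar>"
proof -
  obtain h r where p: "p = of_int h / (real n * real r)" "1 \<le> r" "r \<le> R"
    using assms unfolding farey_points_def by blast
  obtain k t where q: "q = of_int k / (real n * real t)" "1 \<le> t" "t \<le> R"
    using assms unfolding farey_points_def by blast
  have eq: "p - q = of_int (h * int t - k * int r) / (real n * real r * real t)"
    using p(2) q(2) n unfolding p(1) q(1) by (simp add: field_simps)
  with \<open>p \<noteq> q\<close> have "h * int t - k * int r \<noteq> 0"
    by (metis div_0 eq_iff_diff_eq_0 of_int_0)
  then have "1 \<le> \<bar>h * int t - k * int r\<bar>" by linarith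
  then have 1: "1 \<le> \<bar>of_int (h * int t - k * int r) :: real\<bar>"
    by (metis of_int_1_le_iff of_int_abs)
  have "r * t \<le> R\<^sup>2" using p q by (simp add: power2_eq_square mult_le_mono)
  then have "real (r * t) \<le> real (R\<^sup>2)" by (rule of_nat_mono)
  then have 2: "real n * real r * real t \<le> real (n * R\<^sup>2)"
    using n by simp
  have "1 \<le> real n * real r * real t * \<bar>p - q\<bar>"
    using 1 p(2) q(2) n unfolding eq by (simp add: abs_mult)
  also have "\<dots> \<le> real (n * R\<^sup>2) * \<bar>p - q\<bar>"
    by (intro mult_right_mono 2) auto
  finally show ?thesis .
qed

lemma card_farey_points_upper:
  assumes n: "0 < n" and ab: "a < b" and large: "1 \<le> (b - a) * real n"
  shows "real (card (farey_points n R \<inter> {a..b})) \<le> 2 * (b - a) * real (n * R\<^sup>2)"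
proof (cases "R = 0")
  case True
  then show ?thesis by (simp add: farey_points_def)
next
  case False
  have "real (card (farey_points n R \<inter> {a..b})) \<le> 1 + (b - a) * real (n * R\<^sup>2)"
    by (rule card_spaced_le(2)[where x = a])
      (use ab n in \<open>auto intro: farey_points_separated simp del: of_nat_mult\<close>)
  moreover have "(b - a) * real n \<le> (b - a) * real (n * R\<^sup>2)"
    using ab False by (intro mult_left_mono of_nat_mono) auto
  ultimately show ?thesis using large by linarith
qed

lemma finite_farey_points:
  assumes n: "0 < n"
  shows "finite (farey_points n R \<inter> {a..b})"
proof (cases "a \<le> b")
  case True
  then show ?thesis
    by (intro card_spaced_le(1)[where x = a and l = "b - a" and N = "real (n * R\<^sup>2)"])
      (use n in \<open>auto intro: farey_points_separated simp del: of_nat_mult\<close>)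
qed auto

text \<open>By Dirichlet's theorem every point of the interval is close to a point of
  \<^term>\<open>farey_points n R\<close>; points whose denominator is at most \<open>n * R / 16\<close> serve only a
  small part of the interval, so most points are served at distance \<open>16 / (n * R\<^sup>2)\<close>.\<close>

lemma card_farey_points_lower:
  assumes n: "0 < n" and ab: "a < b" and large: "4 \<le> (b - a) * real n"
  shows "(b - a) * real (n * R\<^sup>2) / 128 \<le> real (card (farey_points n R \<inter> {a..b}))"
proof (cases "R = 0")
  case True
  then show ?thesis by simp
next
  case False
  then have R: "0 < R" by simp
  define l where "l = b - a"
  have l: "0 < l" using ab by (simp add: l_def)
  define X where "X = farey_points n R \<inter> {a..b}"
  have finX: "finite X" unfolding X_def using n by (rule finite_farey_points)
  define S where "S = {r. 1 \<le> r \<and> 16 * r \<le> R}"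
  have finS: "finite S" unfolding S_def by (rule finite_subset[of _ "{..R}"]) auto
  define H where "H r = {h::int. of_int h / (real n * real r) \<in> {a..b}}" for r
  have H: "finite (H r)" "real (card (H r)) \<le> 1 + l * (real n * real r)" if "1 \<le> r" for r
  proof -
    let ?g = "\<lambda>h::int. of_int h / (real n * real r)"
    have pos: "0 < real n * real r" using n that by simp
    have inj: "inj_on ?g (H r)" by (rule inj_onI) (use pos in auto)
    have sub: "?g ` H r \<subseteq> {a..a + l}" by (auto simp: H_def l_def)
    have sep: "1 \<le> (real n * real r) * \<bar>p - q\<bar>" if "p \<in> ?g ` H r" "q \<in> ?g ` H r" "p \<noteq> q" for p q
    proof -
      obtain h k where hk: "p = ?g h" "q = ?g k" using \<open>p \<in> _\<close> \<open>q \<in> _\<close> by auto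
      then have "h \<noteq> k" using \<open>p \<noteq> q\<close> by auto
      then have "1 \<le> \<bar>h - k\<bar>" by linarith
      then have "1 \<le> \<bar>of_int (h - k) :: real\<bar>" by (metis of_int_1_le_iff of_int_abs)
      moreover have "p - q = of_int (h - k) / (real n * real r)"
        by (simp add: hk diff_divide_distrib)
      ultimately show ?thesis using pos by (auto simp: abs_mult zero_less_mult_iff)
    qed
    have "finite (?g ` H r)"
      by (rule card_spaced_le(1)[OF sub _ _ sep]) (use l in auto)
    then show "finite (H r)" using inj by (rule finite_imageD)
    have "real (card (?g ` H r)) \<le> 1 + l * (real n * real r)"
      by (rule card_spaced_le(2)[OF sub _ _ sep]) (use l in auto)
    then show "real (card (H r)) \<le> 1 + l * (real n * real r)"
      using inj by (simp add: card_image)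
  qed
  let ?I = "\<lambda>p e. {p - e..p + e::real}"
  define V where "V = (\<Union>p\<in>X. ?I p (16 / real (n * R\<^sup>2)))"
  define Y where "Y r = (\<Union>h\<in>H r. ?I (of_int h / (real n * real r)) (1 / (real n * real r * real R)))" for r
  \<comment> \<open>The Dirichlet fraction \<open>p\<close> of \<open>x\<close> is within
    \<open>1 / n\<close>, which is at most \<open>l / 4\<close> by \<open>large\<close>; the quarter
    margins thus keep it in \<open>{a..b}\<close>. The sets \<open>Y r\<close> take the case of
    \<open>r\<close> at most \<open>R / 16\<close>; otherwise \<open>1 / (n * r * R)\<close> is at
    most the radius used in \<open>V\<close>.\<close>
  have cover: "{a + l / 4..b - l / 4} \<subseteq> V \<union> (\<Union>r\<in>S. Y r)"
  proof
    fix x assume x: "x \<in> {a + l / 4..b - l / 4}"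
    obtain k h where kh: "0 < k" "k \<le> int R" "\<bar>of_int k * (real n * x) - of_int h\<bar> < 1 / real R"
      using Dirichlet_approx[OF R, of "real n * x"] by metis
    define r where "r = nat k"
    have r: "1 \<le> r" "r \<le> R" "real_of_int k = real r" using kh by (auto simp: r_def)
    define p where "p = of_int h / (real n * real r)"
    have pos: "0 < real n * real r" using n r by simp
    have "of_int k * (real n * x) - of_int h = (real n * real r) * (x - p)"
      using n r(1) by (simp add: p_def r(3) field_simps)
    with kh have "(real n * real r) * \<bar>x - p\<bar> < 1 / real R"
      using pos by (simp add: abs_mult)
    then have d: "\<bar>x - p\<bar> < 1 / (real n * real r * real R)"
      using pos R by (simp add: field_simps)
    also have "\<dots> \<le> 1 / (real n * 1 * 1)"
      using n r R by (intro divide_left_mono mult_mono) auto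
    also have "\<dots> \<le> l / 4" using large n by (simp add: l_def field_simps)
    finally have "\<bar>x - p\<bar> < l / 4" .
    then have p: "p \<in> {a..b}" using x unfolding atLeastAtMost_iff by linarith
    show "x \<in> V \<union> (\<Union>r\<in>S. Y r)"
    proof (cases "r \<in> S")
      case True
      have "h \<in> H r" using p by (simp add: H_def p_def)
      moreover have "x \<in> ?I p (1 / (real n * real r * real R))" using d by auto
      ultimately show ?thesis using True unfolding Y_def p_def by blast
    next
      case False
      then have "R \<le> 16 * r" using r by (simp add: S_def)
      then have "real R \<le> 16 * real r" by linarith
      then have "1 / (real n * real r * real R) \<le> 16 / real (n * R\<^sup>2)"
        using n r R by (simp add: field_simps power2_eq_square)
      moreover have "p \<in> X" using p r unfolding X_def farey_points_def p_def by blast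
      ultimately show ?thesis using d unfolding V_def by force
    qed
  qed
  have Vm: "V \<in> sets lborel" unfolding V_def using finX by (intro sets.finite_UN) auto
  have Ym: "Y r \<in> sets lborel" if "r \<in> S" for r
    unfolding Y_def using H that by (intro sets.finite_UN) (auto simp: S_def)
  have eV: "emeasure lborel V \<le> ennreal (real (card X) * (32 / real (n * R\<^sup>2)))"
  proof -
    have "emeasure lborel V \<le> (\<Sum>p\<in>X. emeasure lborel (?I p (16 / real (n * R\<^sup>2))))"
      unfolding V_def by (rule emeasure_subadditive_finite[OF finX]) auto
    also have "\<dots> = (\<Sum>p\<in>X. ennreal (32 / real (n * R\<^sup>2)))"
      by (intro sum.cong) auto
    also have "\<dots> = ennreal (\<Sum>p\<in>X. 32 / real (n * R\<^sup>2))"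
      by (rule sum_ennreal) auto
    finally show ?thesis by simp
  qed
  \<comment> \<open>There are at most \<open>2 * l * n * r\<close> numerators, each with an interval
    of length \<open>2 / (n * r * R)\<close>. The bound is the same for all \<open>r\<close>, and
    \<open>S\<close> has at most \<open>R / 16\<close> elements, which gives \<open>l / 4\<close> in
    total.\<close>
  have eY: "emeasure lborel (Y r) \<le> ennreal (4 * l / real R)" if "r \<in> S" for r
  proof -
    have r1: "1 \<le> r" using that by (simp add: S_def)
    let ?e = "1 / (real n * real r * real R)"
    have "emeasure lborel (Y r) \<le> (\<Sum>h\<in>H r. emeasure lborel (?I (of_int h / (real n * real r)) ?e))"
      unfolding Y_def by (rule emeasure_subadditive_finite[OF H(1)[OF r1]]) auto
    also have "\<dots> = (\<Sum>h\<in>H r. ennreal (2 * ?e))"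
      by (intro sum.cong) auto
    also have "\<dots> = ennreal (\<Sum>h\<in>H r. 2 * ?e)"
      by (rule sum_ennreal) auto
    also have "\<dots> = ennreal (real (card (H r)) * (2 * ?e))" by simp
    also have "\<dots> \<le> ennreal (4 * l / real R)"
    proof (rule ennreal_leI)
      have rr: "1 \<le> real r" using r1 by simp
      have "1 \<le> l * real n" using large by (simp add: l_def)
      also have "\<dots> \<le> l * (real n * real r)" using l n rr by simp
      finally have "1 + l * (real n * real r) \<le> 2 * (l * (real n * real r))" by simp
      with H(2)[OF r1] have "real (card (H r)) \<le> 2 * (l * (real n * real r))" by linarith
      then have "real (card (H r)) * (2 * ?e) \<le> 2 * (l * (real n * real r)) * (2 * ?e)"
        by (intro mult_right_mono) auto
      also have "\<dots> = 4 * l / real R" using n r1 R by simp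
      finally show "real (card (H r)) * (2 * ?e) \<le> 4 * l / real R" .
    qed
    finally show ?thesis .
  qed
  have cardS: "16 * real (card S) \<le> real R"
  proof -
    have "S \<subseteq> {1..R div 16}" by (auto simp: S_def)
    then have "card S \<le> R div 16" using card_mono[of "{1..R div 16}" S] by simp
    then have "16 * card S \<le> R" by linarith
    then show ?thesis by linarith
  qed
  have eYS: "emeasure lborel (\<Union>r\<in>S. Y r) \<le> ennreal (l / 4)"
  proof -
    have "emeasure lborel (\<Union>r\<in>S. Y r) \<le> (\<Sum>r\<in>S. emeasure lborel (Y r))"
      by (rule emeasure_subadditive_finite[OF finS]) (use Ym in auto)
    also have "\<dots> \<le> (\<Sum>r\<in>S. ennreal (4 * l / real R))"
      by (intro sum_mono eY)
    also have "\<dots> = ennreal (\<Sum>r\<in>S. 4 * l / real R)"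
      by (rule sum_ennreal) (use l in auto)
    also have "\<dots> = ennreal (real (card S) * (4 * l / real R))" by simp
    also have "\<dots> \<le> ennreal (l / 4)"
    proof (rule ennreal_leI)
      have "real (card S) * (4 * l / real R) \<le> (real R / 16) * (4 * l / real R)"
        using cardS l R by (intro mult_right_mono) auto
      also have "\<dots> = l / 4" using R by simp
      finally show "real (card S) * (4 * l / real R) \<le> l / 4" .
    qed
    finally show ?thesis .
  qed
  \<comment> \<open>The middle half has length \<open>l / 2\<close>, so \<open>V\<close> must
    account for at least \<open>l / 4\<close>; it consists of \<open>card X\<close> intervals of
    length \<open>32 / (n * R\<^sup>2)\<close>, whence the constant 128.\<close>
  have "ennreal (l / 2) = emeasure lborel {a + l / 4..b - l / 4}"
    using l by (simp add: l_def field_simps)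
  also have "\<dots> \<le> emeasure lborel (V \<union> (\<Union>r\<in>S. Y r))"
    using Vm Ym finS by (intro emeasure_mono[OF cover] sets.Un sets.finite_UN) auto
  also have "\<dots> \<le> emeasure lborel V + emeasure lborel (\<Union>r\<in>S. Y r)"
    by (rule emeasure_subadditive) (use Vm Ym finS in \<open>auto intro: sets.finite_UN\<close>)
  also have "\<dots> \<le> ennreal (real (card X) * (32 / real (n * R\<^sup>2))) + ennreal (l / 4)"
    by (intro add_mono eV eYS)
  also have "\<dots> = ennreal (real (card X) * (32 / real (n * R\<^sup>2)) + l / 4)"
    by (rule ennreal_plus[symmetric]) (use l in auto)
  finally have "l / 2 \<le> real (card X) * (32 / real (n * R\<^sup>2)) + l / 4"
    using l by (subst (asm) ennreal_le_iff) auto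
  then have "l / 4 \<le> real (card X) * 32 / real (n * R\<^sup>2)" by simp
  then have "l / 4 * real (n * R\<^sup>2) \<le> real (card X) * 32"
    using n R by (subst (asm) pos_le_divide_eq) auto
  then show ?thesis unfolding X_def l_def by (simp add: field_simps)
qed

section \<open>Ubiquity and full measure\<close>

text \<open>Cauchy-Schwarz for the sum of the indicators of the \<open>A i\<close> against the
  indicator of their union, obtained from a quadratic polynomial in \<open>c\<close> that is
  nonnegative. Moderate overlaps thus force a large union.\<close>

lemma chung_erdos:
  assumes fin: "finite I" and A: "\<And>i. i \<in> I \<Longrightarrow> A i \<in> fmeasurable M"
  shows "(\<Sum>i\<in>I. measure M (A i))\<^sup>2 \<le>
    measure M (\<Union>i\<in>I. A i) * (\<Sum>i\<in>I. \<Sum>j\<in>I. measure M (A i \<inter> A j))"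
proof -
  define U where "U = (\<Union>i\<in>I. A i)"
  define S where "S = (\<Sum>i\<in>I. measure M (A i))"
  define Q where "Q = (\<Sum>i\<in>I. \<Sum>j\<in>I. measure M (A i \<inter> A j))"
  have U: "U \<in> fmeasurable M" unfolding U_def using fin A by (intro fmeasurable.finite_UN) auto
  have ind: "integrable M (indicator B :: _ \<Rightarrow> real)" if "B \<in> fmeasurable M" for B
    using that by (simp add: fmeasurable_def integrable_indicator_iff)
  have AA: "A i \<inter> A j \<in> fmeasurable M" if "i \<in> I" "j \<in> I" for i j
    using A that by (blast intro: fmeasurable.Int)
  have key: "0 \<le> Q - 2 * c * S + c\<^sup>2 * measure M U" for c :: real
  proof -
    let ?F = "\<lambda>x. \<Sum>i\<in>I. indicator (A i) x :: real"
    have exp: "(?F x - c * indicator U x)\<^sup>2 =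
        (\<Sum>i\<in>I. \<Sum>j\<in>I. indicator (A i \<inter> A j) x) - 2 * c * ?F x + c\<^sup>2 * indicator U x" for x
    proof -
      have "?F x * indicator U x = ?F x"
        unfolding sum_distrib_right by (intro sum.cong) (auto simp: U_def indicator_def)
      moreover have "(?F x)\<^sup>2 = (\<Sum>i\<in>I. \<Sum>j\<in>I. indicator (A i \<inter> A j) x)"
        by (simp add: power2_eq_square sum_product indicator_inter_arith)
      moreover have "(indicator U x)\<^sup>2 = (indicator U x :: real)"
        by (simp add: indicator_def)
      ultimately show ?thesis
        by (simp add: power2_diff power_mult_distrib algebra_simps)
    qed
    have i1: "integrable M (\<lambda>x. \<Sum>i\<in>I. \<Sum>j\<in>I. indicator (A i \<inter> A j) x :: real)"
      using AA by (intro Bochner_Integration.integrable_sum ind) auto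
    have i2: "integrable M ?F"
      using A by (intro Bochner_Integration.integrable_sum ind) auto
    have "0 \<le> (\<integral>x. (?F x - c * indicator U x)\<^sup>2 \<partial>M)"
      by (rule integral_nonneg_AE) auto
    also have "\<dots> = (\<integral>x. (\<Sum>i\<in>I. \<Sum>j\<in>I. indicator (A i \<inter> A j) x) - 2 * c * ?F x + c\<^sup>2 * indicator U x \<partial>M)"
      by (simp only: exp)
    also have "\<dots> = (\<integral>x. (\<Sum>i\<in>I. \<Sum>j\<in>I. indicator (A i \<inter> A j) x) \<partial>M)
        - 2 * c * (\<integral>x. ?F x \<partial>M) + c\<^sup>2 * (\<integral>x. indicator U x \<partial>M)"
      using i1 i2 ind[OF U] by (simp add: Bochner_Integration.integral_add Bochner_Integration.integral_diff)
    also have "(\<integral>x. (\<Sum>i\<in>I. \<Sum>j\<in>I. indicator (A i \<inter> A j) x) \<partial>M) = Q"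
    proof -
      have "(\<integral>x. (\<Sum>i\<in>I. \<Sum>j\<in>I. indicator (A i \<inter> A j) x :: real) \<partial>M) =
          (\<Sum>i\<in>I. \<integral>x. (\<Sum>j\<in>I. indicator (A i \<inter> A j) x :: real) \<partial>M)"
        using AA by (intro Bochner_Integration.integral_sum Bochner_Integration.integrable_sum ind) auto
      also have "\<dots> = (\<Sum>i\<in>I. \<Sum>j\<in>I. \<integral>x. (indicator (A i \<inter> A j) x :: real) \<partial>M)"
        using AA by (intro sum.cong refl Bochner_Integration.integral_sum ind) auto
      also have "\<dots> = Q" unfolding Q_def
        using AA[THEN fmeasurableD, THEN sets.sets_into_space]
        by (intro sum.cong refl) (simp add: Int_absorb2)
      finally show ?thesis .
    qed
    also have "(\<integral>x. ?F x \<partial>M) = S"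
    proof -
      have "(\<integral>x. ?F x \<partial>M) = (\<Sum>i\<in>I. \<integral>x. (indicator (A i) x :: real) \<partial>M)"
        using A by (intro Bochner_Integration.integral_sum ind) auto
      also have "\<dots> = S" unfolding S_def
        using A[THEN fmeasurableD, THEN sets.sets_into_space]
        by (intro sum.cong refl) (simp add: Int_absorb2)
      finally show ?thesis .
    qed
    also have "(\<integral>x. indicator U x \<partial>M) = measure M U"
      using U[THEN fmeasurableD, THEN sets.sets_into_space] by (simp add: Int_absorb2)
    finally show ?thesis .
  qed
  show ?thesis
  proof (cases "measure M U = 0")
    case True
    have "measure M (A i) = 0" if "i \<in> I" for i
    proof -
      have "measure M (A i) \<le> measure M U"
        using A U that by (intro measure_mono_fmeasurable) (auto simp: U_def)
      then show ?thesis using True by (simp add: measure_le_0_iff)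
    qed
    then have "S = 0" by (simp add: S_def)
    then show ?thesis using True by (simp add: S_def U_def)
  next
    case False
    then have pos: "0 < measure M U" by (simp add: zero_less_measure_iff)
    have "0 \<le> measure M U * (Q - 2 * (S / measure M U) * S + (S / measure M U)\<^sup>2 * measure M U)"
      using key[of "S / measure M U"] pos by (intro mult_nonneg_nonneg) auto
    also have "\<dots> = measure M U * Q - S\<^sup>2"
      using pos by (simp add: field_simps power2_eq_square)
    finally show ?thesis by (simp add: S_def Q_def U_def)
  qed
qed

section \<open>Second moment bounds for balls around well-spaced points\<close>

lemma measure_lebesgue_ball_real:
  fixes x :: real assumes "0 \<le> e"
  shows "measure lebesgue (ball x e) = 2 * e"
  using assms by (simp add: ball_eq_greaterThanLessThan)

text \<open>\<open>N t\<close> is the order of the number of points of \<open>P t\<close> per unit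
  length, so for large \<open>t\<close> the product \<open>r t * N t\<close> is comparable to the
  total length of the balls of level \<open>t\<close> per unit length, and \<open>diverges\<close>
  is the divergence condition of Borel-Cantelli. \<open>decay\<close> keeps the correlations between
  levels summable.\<close>

locale ubiquitous_system =
  fixes P :: "nat \<Rightarrow> real set" and N r :: "nat \<Rightarrow> real" and \<kappa> \<gamma> :: real
  assumes \<kappa>_pos: "0 < \<kappa>" and \<gamma>: "0 < \<gamma>" "\<gamma> < 1"
    and r_pos: "\<And>t. 0 < r t" and N_nonneg: "\<And>t. 0 \<le> N t"
    and separated: "\<And>t p q. p \<in> P t \<Longrightarrow> q \<in> P t \<Longrightarrow> p \<noteq> q \<Longrightarrow> 1 \<le> N t * \<bar>p - q\<bar>"
    and card_lower: "\<And>a b. a < b \<Longrightarrow> \<forall>\<^sub>F t in sequentially. \<kappa> * (b - a) * N t \<le> real (card (P t \<inter> {a..b}))"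
    and card_upper: "\<And>a b. a < b \<Longrightarrow> \<forall>\<^sub>F t in sequentially. real (card (P t \<inter> {a..b})) \<le> 2 * (b - a) * N t"
    and decay: "\<And>t k. r (t + k) \<le> \<gamma> ^ k * r t"
    and diverges: "\<not> summable (\<lambda>t. r t * N t)"
begin

lemma radius_tendsto_0: "r \<longlonglongrightarrow> 0"
proof (rule tendsto_sandwich)
  show "\<forall>\<^sub>F t in sequentially. 0 \<le> r t" using r_pos by (simp add: less_imp_le)
  show "\<forall>\<^sub>F t in sequentially. r t \<le> \<gamma> ^ t * r 0" using decay[of 0] by simp
  show "(\<lambda>t. \<gamma> ^ t * r 0) \<longlonglongrightarrow> 0"
    using \<gamma> by (intro tendsto_mult_left_zero LIMSEQ_power_zero) auto
qed simp

lemma card_near_le: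
  "finite (P t \<inter> {x - e..x + e})" "0 \<le> e \<Longrightarrow> real (card (P t \<inter> {x - e..x + e})) \<le> 1 + 2 * e * N t"
proof -
  have *: "finite (P t \<inter> {x - e..x + e}) \<and> real (card (P t \<inter> {x - e..x + e})) \<le> 1 + 2 * e * N t"
    if "0 \<le> e"
  proof -
    have "P t \<inter> {x - e..x + e} \<subseteq> {x - e..(x - e) + 2 * e}" by auto
    from card_spaced_le[OF this N_nonneg[of t]] show ?thesis using separated that by auto
  qed
  show "0 \<le> e \<Longrightarrow> real (card (P t \<inter> {x - e..x + e})) \<le> 1 + 2 * e * N t" using * by simp
  show "finite (P t \<inter> {x - e..x + e})" using * by (cases "0 \<le> e") auto
qed

lemma finite_points: "finite (P t \<inter> {a..b})"
  using card_near_le(1)[of t "(a + b) / 2" "(b - a) / 2"] by (simp add: field_simps)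

definition neighbourhood :: "nat \<Rightarrow> real set" where
  "neighbourhood T = (\<Union>t\<in>{T..}. \<Union>p\<in>P t. ball p (r t))"

lemma open_neighbourhood: "open (neighbourhood T)"
  unfolding neighbourhood_def by auto

text \<open>A ball of level \<open>t\<close> meets only balls of level \<open>u\<close> with centres
  within \<open>2 * r t\<close>, of which there are at most \<open>1 + 4 * r t * N u\<close>. The
  second summand gives the product expected under independence; the first gives a term that decays
  with \<open>u - t\<close>.\<close>

lemma overlap_le:
  assumes tu: "t \<le> u" and fin: "finite X" and X: "real (card X) \<le> 2 * l * N t" and YP: "Y \<subseteq> P u"
    and finY: "finite Y" and l: "0 \<le> l"
  shows "(\<Sum>p\<in>X. \<Sum>q\<in>Y. measure lebesgue (ball p (r t) \<inter> ball q (r u)))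
    \<le> 4 * l * (\<gamma> ^ (u - t) * (r t * N t)) + 16 * l * ((r t * N t) * (r u * N u))"
proof -
  have ru: "r u \<le> \<gamma> ^ (u - t) * r t" using decay[of t "u - t"] tu by simp
  also have "\<dots> \<le> 1 * r t" using \<gamma> r_pos[of t] by (intro mult_right_mono power_le_one) auto
  finally have rr: "r u \<le> r t" by simp
  have one: "(\<Sum>q\<in>Y. measure lebesgue (ball p (r t) \<inter> ball q (r u))) \<le> 2 * r u * (1 + 4 * r t * N u)" for p
  proof -
    let ?Z = "P u \<inter> {p - 2 * r t..p + 2 * r t}"
    have "(\<Sum>q\<in>Y. measure lebesgue (ball p (r t) \<inter> ball q (r u))) \<le> (\<Sum>q\<in>Y. if q \<in> ?Z then 2 * r u else 0)"
    proof (rule sum_mono)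
      fix q assume q: "q \<in> Y"
      show "measure lebesgue (ball p (r t) \<inter> ball q (r u)) \<le> (if q \<in> ?Z then 2 * r u else 0)"
      proof (cases "q \<in> ?Z")
        case True
        have "measure lebesgue (ball p (r t) \<inter> ball q (r u)) \<le> measure lebesgue (ball q (r u))"
          by (rule measure_mono_fmeasurable) auto
        then show ?thesis using True measure_lebesgue_ball_real[of "r u" q] r_pos[of u] by simp
      next
        case False
        then have "2 * r t < \<bar>p - q\<bar>" using q YP by auto
        have "ball p (r t) \<inter> ball q (r u) = {}"
        proof (rule ccontr)
          assume "ball p (r t) \<inter> ball q (r u) \<noteq> {}"
          then obtain x where "\<bar>p - x\<bar> < r t" "\<bar>q - x\<bar> < r u" by (auto simp: dist_real_def)
          then show False using \<open>2 * r t < \<bar>p - q\<bar>\<close> rr by linarith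
        qed
        then show ?thesis using False by (simp only: if_False) simp
      qed
    qed
    also have "\<dots> = real (card (Y \<inter> ?Z)) * (2 * r u)"
      using finY by (simp add: sum.If_cases Collect_mem_eq del: Int_iff)
    also have "\<dots> \<le> real (card ?Z) * (2 * r u)"
      using r_pos[of u] card_near_le(1) by (intro mult_right_mono of_nat_mono card_mono) auto
    also have "\<dots> \<le> (1 + 2 * (2 * r t) * N u) * (2 * r u)"
      using r_pos[of t] r_pos[of u] by (intro mult_right_mono card_near_le) auto
    finally show ?thesis by (simp add: mult.commute)
  qed
  have "(\<Sum>p\<in>X. \<Sum>q\<in>Y. measure lebesgue (ball p (r t) \<inter> ball q (r u))) \<le> real (card X) * (2 * r u * (1 + 4 * r t * N u))"
    using sum_mono[of X, OF one] by simp
  also have "\<dots> \<le> 2 * l * N t * (2 * r u * (1 + 4 * r t * N u))"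
    using X r_pos[of t] r_pos[of u] N_nonneg[of u] by (intro mult_right_mono) auto
  also have "\<dots> = 4 * l * N t * r u + 16 * l * ((r t * N t) * (r u * N u))"
    by (simp add: algebra_simps)
  also have "4 * l * N t * r u \<le> 4 * l * N t * (\<gamma> ^ (u - t) * r t)"
    using l N_nonneg[of t] ru by (intro mult_left_mono) auto
  finally show ?thesis by (simp add: mult_ac)
qed

lemma geometric_tail_le: "(\<Sum>u\<in>{a..<b}. \<gamma> ^ (u - a)) \<le> 1 / (1 - \<gamma>)"
proof -
  have "(\<Sum>u\<in>{a..<b}. \<gamma> ^ (u - a)) = (\<Sum>k<b - a. \<gamma> ^ k)"
    by (rule sum.reindex_bij_witness[of _ "\<lambda>k. k + a" "\<lambda>u. u - a"]) auto
  also have "\<dots> = (1 - \<gamma> ^ (b - a)) / (1 - \<gamma>)" using \<gamma> by (simp add: sum_gp_strict)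
  also have "\<dots> \<le> 1 / (1 - \<gamma>)" using \<gamma> by (intro divide_right_mono) auto
  finally show ?thesis .
qed

text \<open>The proportion that \<open>chung_erdos\<close> yields on an interval; it is the same for
  all intervals, which the density argument needs.\<close>

definition density :: real where
  "density = 2 * \<kappa>\<^sup>2 / (8 / (1 - \<gamma>) + 16)"

lemma density_pos: "0 < density"
  using \<kappa>_pos \<gamma> by (auto simp: density_def intro!: divide_pos_pos add_pos_pos)

text \<open>\<open>chung_erdos\<close> is applied to all balls of finitely many levels with centres
  in the middle half of the interval, and \<open>overlap_le\<close> bounds the second
  moment.\<close>

lemma local_measure_lower:
  assumes ab: "a < b"
  shows "density * (b - a) \<le> measure lebesgue ({a..b} \<inter> neighbourhood T)"
proof -
  define l where "l = (b - a) / 2"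
  \<comment> \<open>A ball with centre in the middle half and radius below
    \<open>(b - a) / 4\<close> stays inside \<open>{a..b}\<close>.\<close>
  define a' b' where "a' = a + (b - a) / 4" and "b' = b - (b - a) / 4"
  have l: "0 < l" "b' - a' = l" "a' < b'" using ab by (auto simp: l_def a'_def b'_def field_simps)
  have "\<forall>\<^sub>F t in sequentially. r t < (b - a) / 4"
    using radius_tendsto_0 ab by (intro order_tendstoD(2)[of _ 0]) auto
  then have "\<forall>\<^sub>F t in sequentially. T \<le> t \<and> r t < (b - a) / 4 \<and>
      \<kappa> * (b' - a') * N t \<le> real (card (P t \<inter> {a'..b'})) \<and> real (card (P t \<inter> {a'..b'})) \<le> 2 * (b' - a') * N t"
    using card_lower[OF l(3)] card_upper[OF l(3)] eventually_ge_at_top[of T] by eventually_elim auto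
  then obtain T1 where T1: "\<And>t. t \<ge> T1 \<Longrightarrow> T \<le> t \<and> r t < (b - a) / 4 \<and>
      \<kappa> * l * N t \<le> real (card (P t \<inter> {a'..b'})) \<and> real (card (P t \<inter> {a'..b'})) \<le> 2 * l * N t"
    unfolding eventually_sequentially l(2) by blast
  define g where "g t = r t * N t" for t
  have g0: "0 \<le> g t" for t using r_pos[of t] N_nonneg[of t] by (simp add: g_def)
  \<comment> \<open>Divergence provides a window of levels whose sum \<open>G\<close> is at least 1;
    then \<open>G \<le> G\<^sup>2\<close>, and the part of the second moment that is linear in
    \<open>G\<close> is absorbed by the quadratic one.\<close>
  obtain M where M: "1 \<le> (\<Sum>t\<in>{T1..<M}. g t)"
  proof (rule ccontr)
    assume no: "\<not> thesis"
    have "summable (\<lambda>t. g (t + T1))"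
    proof (rule summableI_nonneg_bounded)
      show "(\<Sum>t<n. g (t + T1)) \<le> 1" for n
      proof -
        have "(\<Sum>t<n. g (t + T1)) = (\<Sum>t\<in>{T1..<n + T1}. g t)"
          by (rule sum.reindex_bij_witness[of _ "\<lambda>u. u - T1" "\<lambda>k. k + T1"]) auto
        then show ?thesis using no that[of "n + T1"] by linarith
      qed
    qed (use g0 in auto)
    then have "summable g" by (simp only: summable_iff_shift)
    then show False using diverges by (simp add: g_def[abs_def])
  qed
  define G where "G = (\<Sum>t\<in>{T1..<M}. g t)"
  define X where "X t = P t \<inter> {a'..b'}" for t
  define I where "I = (SIGMA t:{T1..<M}. X t)"
  define A where "A = (\<lambda>(t, p::real). ball p (r t))"
  have finX: "finite (X t)" for t by (simp add: X_def finite_points)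
  have finI: "finite I" using finX by (simp add: I_def)
  have sumI: "(\<Sum>i\<in>I. f i) = (\<Sum>t\<in>{T1..<M}. \<Sum>p\<in>X t. f (t, p))" for f :: "nat \<times> real \<Rightarrow> real"
    unfolding I_def using finX by (subst sum.Sigma) auto
  have sum1: "2 * \<kappa> * l * G \<le> (\<Sum>i\<in>I. measure lebesgue (A i))"
  proof -
    have "(\<Sum>i\<in>I. measure lebesgue (A i)) = (\<Sum>t\<in>{T1..<M}. \<Sum>p\<in>X t. measure lebesgue (ball p (r t)))"
      by (simp only: sumI A_def prod.case)
    also have "\<dots> = (\<Sum>t\<in>{T1..<M}. 2 * r t * real (card (X t)))"
      unfolding measure_lebesgue_ball_real[OF less_imp_le[OF r_pos]] by (simp add: mult.commute)
    also have "\<dots> \<ge> (\<Sum>t\<in>{T1..<M}. 2 * r t * (\<kappa> * l * N t))"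
      using T1 r_pos by (intro sum_mono mult_left_mono) (auto simp: X_def less_imp_le)
    also have "(\<Sum>t\<in>{T1..<M}. 2 * r t * (\<kappa> * l * N t)) = 2 * \<kappa> * l * G"
      by (simp add: G_def g_def sum_distrib_left mult_ac)
    finally show ?thesis .
  qed
  let ?S = "\<lambda>t u. \<Sum>p\<in>X t. \<Sum>q\<in>X u. measure lebesgue (ball p (r t) \<inter> ball q (r u))"
  let ?h = "\<lambda>t u. if t \<le> u then \<gamma> ^ (u - t) * g t else 0"
  have S_le: "?S t u \<le> 4 * l * (?h t u + ?h u t) + 16 * l * (g t * g u)"
    if "t \<in> {T1..<M}" "u \<in> {T1..<M}" for t u
  proof -
    have X2: "real (card (X t)) \<le> 2 * l * N t" "real (card (X u)) \<le> 2 * l * N u"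
      using T1 that by (auto simp: X_def)
    have h0: "0 \<le> ?h t u" for t u using g0 \<gamma> by auto
    show ?thesis
    proof (cases "t \<le> u")
      case True
      have "?S t u \<le> 4 * l * (\<gamma> ^ (u - t) * g t) + 16 * l * (g t * g u)"
        unfolding g_def using True X2 finX l
        by (intro overlap_le) (auto simp: X_def)
      also have "4 * l * (\<gamma> ^ (u - t) * g t) \<le> 4 * l * (?h t u + ?h u t)"
        using h0[of u t] True l by (intro mult_left_mono) auto
      finally show ?thesis by simp
    next
      case False
      have "?S t u = (\<Sum>q\<in>X u. \<Sum>p\<in>X t. measure lebesgue (ball q (r u) \<inter> ball p (r t)))"
        by (subst sum.swap) (simp add: Int_commute)
      also have "\<dots> \<le> 4 * l * (\<gamma> ^ (t - u) * g u) + 16 * l * (g u * g t)"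
        unfolding g_def using False X2 finX l
        by (intro overlap_le) (auto simp: X_def)
      also have "4 * l * (\<gamma> ^ (t - u) * g u) \<le> 4 * l * (?h t u + ?h u t)"
        using h0[of t u] False l by (intro mult_left_mono) auto
      finally show ?thesis by (simp add: mult_ac)
    qed
  qed
  have hsum: "(\<Sum>t\<in>{T1..<M}. \<Sum>u\<in>{T1..<M}. ?h t u) \<le> G / (1 - \<gamma>)"
  proof -
    have "(\<Sum>u\<in>{T1..<M}. ?h t u) \<le> g t * (1 / (1 - \<gamma>))" if "t \<in> {T1..<M}" for t
    proof -
      have "(\<Sum>u\<in>{T1..<M}. ?h t u) = (\<Sum>u\<in>{t..<M}. g t * \<gamma> ^ (u - t))"
        using that by (intro sum.mono_neutral_cong_right) auto
      also have "\<dots> = g t * (\<Sum>u\<in>{t..<M}. \<gamma> ^ (u - t))" by (simp add: sum_distrib_left)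
      also have "\<dots> \<le> g t * (1 / (1 - \<gamma>))" using g0 by (intro mult_left_mono geometric_tail_le)
      finally show ?thesis .
    qed
    then have "(\<Sum>t\<in>{T1..<M}. \<Sum>u\<in>{T1..<M}. ?h t u) \<le> (\<Sum>t\<in>{T1..<M}. g t * (1 / (1 - \<gamma>)))"
      by (rule sum_mono)
    also have "\<dots> = G / (1 - \<gamma>)" by (simp add: G_def sum_divide_distrib)
    finally show ?thesis .
  qed
  have sum2: "(\<Sum>i\<in>I. \<Sum>j\<in>I. measure lebesgue (A i \<inter> A j)) \<le> l * (8 / (1 - \<gamma>) + 16) * G\<^sup>2"
  proof -
    have "(\<Sum>i\<in>I. \<Sum>j\<in>I. measure lebesgue (A i \<inter> A j)) =
        (\<Sum>t\<in>{T1..<M}. \<Sum>p\<in>X t. \<Sum>u\<in>{T1..<M}. \<Sum>q\<in>X u. measure lebesgue (ball p (r t) \<inter> ball q (r u)))"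
      by (simp only: sumI A_def prod.case)
    also have "\<dots> = (\<Sum>t\<in>{T1..<M}. \<Sum>u\<in>{T1..<M}. ?S t u)"
      by (intro sum.cong refl sum.swap)
    also have "\<dots> \<le> (\<Sum>t\<in>{T1..<M}. \<Sum>u\<in>{T1..<M}. 4 * l * (?h t u + ?h u t) + 16 * l * (g t * g u))"
      by (intro sum_mono S_le)
    also have "\<dots> = 4 * l * ((\<Sum>t\<in>{T1..<M}. \<Sum>u\<in>{T1..<M}. ?h t u) + (\<Sum>t\<in>{T1..<M}. \<Sum>u\<in>{T1..<M}. ?h u t)) + 16 * l * (G * G)"
      by (simp only: sum.distrib sum_distrib_left[symmetric] G_def sum_product)
    also have "(\<Sum>t\<in>{T1..<M}. \<Sum>u\<in>{T1..<M}. ?h u t) = (\<Sum>t\<in>{T1..<M}. \<Sum>u\<in>{T1..<M}. ?h t u)"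
      by (rule sum.swap)
    also have "4 * l * ((\<Sum>t\<in>{T1..<M}. \<Sum>u\<in>{T1..<M}. ?h t u) + (\<Sum>t\<in>{T1..<M}. \<Sum>u\<in>{T1..<M}. ?h t u)) + 16 * l * (G * G)
        \<le> 4 * l * (G / (1 - \<gamma>) + G / (1 - \<gamma>)) + 16 * l * (G * G)"
      using l hsum by (intro add_right_mono mult_left_mono add_mono) auto
    also have "\<dots> = l * (8 / (1 - \<gamma>)) * G + 16 * l * (G * G)" by simp
    also have "\<dots> \<le> l * (8 / (1 - \<gamma>)) * (G * G) + 16 * l * (G * G)"
    proof -
      have "G \<le> G * G" using M mult_left_mono[of 1 G G] by (simp add: G_def)
      then show ?thesis using l \<gamma> by (intro add_right_mono mult_left_mono) auto
    qed
    finally show ?thesis by (simp add: algebra_simps power2_eq_square)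
  qed
  have Alm: "A i \<in> lmeasurable" for i by (simp add: A_def case_prod_unfold)
  have "(2 * \<kappa> * l * G)\<^sup>2 \<le> (\<Sum>i\<in>I. measure lebesgue (A i))\<^sup>2"
    using sum1 \<kappa>_pos l M by (intro power_mono) (auto simp: G_def)
  also have "\<dots> \<le> measure lebesgue (\<Union>i\<in>I. A i) * (\<Sum>i\<in>I. \<Sum>j\<in>I. measure lebesgue (A i \<inter> A j))"
    using finI Alm by (rule chung_erdos)
  also have "\<dots> \<le> measure lebesgue (\<Union>i\<in>I. A i) * (l * (8 / (1 - \<gamma>) + 16) * G\<^sup>2)"
    using sum2 by (intro mult_left_mono) auto
  finally have main: "(2 * \<kappa> * l * G)\<^sup>2 \<le> measure lebesgue (\<Union>i\<in>I. A i) * (l * (8 / (1 - \<gamma>) + 16) * G\<^sup>2)" .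
  have c: "0 < 8 / (1 - \<gamma>) + 16" using \<gamma> by (auto intro!: add_pos_pos)
  have G: "0 < G" using M by (simp add: G_def)
  have "4 * \<kappa>\<^sup>2 * l / (8 / (1 - \<gamma>) + 16) = (2 * \<kappa> * l * G)\<^sup>2 / (l * (8 / (1 - \<gamma>) + 16) * G\<^sup>2)"
    using l G by (simp add: power2_eq_square)
  also have "\<dots> \<le> measure lebesgue (\<Union>i\<in>I. A i)"
    using main l G c by (subst pos_divide_le_eq) auto
  also have "\<dots> \<le> measure lebesgue ({a..b} \<inter> neighbourhood T)"
  proof (rule measure_mono_fmeasurable)
    show "(\<Union>i\<in>I. A i) \<subseteq> {a..b} \<inter> neighbourhood T"
    proof
      fix x assume "x \<in> (\<Union>i\<in>I. A i)"
      then obtain t p where *: "T1 \<le> t" "p \<in> X t" "dist p x < r t" by (auto simp: I_def A_def)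
      then have "T \<le> t" "r t < (b - a) / 4" using T1 by auto
      moreover have p: "a' \<le> p" "p \<le> b'" "p \<in> P t" using * by (auto simp: X_def)
      moreover have "\<bar>p - x\<bar> < r t" using *(3) by (simp add: dist_real_def)
      ultimately have "a \<le> x" "x \<le> b" unfolding a'_def b'_def by linarith+
      then show "x \<in> {a..b} \<inter> neighbourhood T"
        using *(3) p(3) \<open>T \<le> t\<close> by (auto simp: neighbourhood_def)
    qed
    show "{a..b} \<inter> neighbourhood T \<in> lmeasurable"
      using open_neighbourhood by (intro bounded_set_imp_lmeasurable bounded_Int sets.Int) auto
  qed (use finI Alm in auto)
  finally show ?thesis by (simp add: density_def l_def mult_ac)
qed

end

text \<open>A direct form of the Lebesgue density argument. If the complement \<open>S\<close>
  inside an interval had positive measure, cover it by nonoverlapping intervals of only slightly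
  larger total length: \<open>U\<close> takes a proportion \<open>c\<close> of each of them, and too
  little is left for \<open>S\<close>.\<close>

lemma negligible_compl_if_locally_dense:
  fixes U :: "real set"
  assumes c: "0 < c" and U: "U \<in> sets lebesgue"
    and dens: "\<And>a b. a < b \<Longrightarrow> c * (b - a) \<le> measure lebesgue ({a..b} \<inter> U)"
  shows "negligible (- U)"
  unfolding negligible_on_intervals[of "- U"]
proof (intro allI)
  fix a b :: real
  have lmU: "{x..y} \<inter> U \<in> lmeasurable" "{x..y} - U \<in> lmeasurable" for x y
    using U by (auto intro!: bounded_set_imp_lmeasurable intro: bounded_subset[of "{x..y}"])
  have dens': "measure lebesgue ({x..y} - U) \<le> (1 - c) * measure lebesgue {x..y}" for x y
  proof (cases "x < y")
    case True
    have "measure lebesgue {x..y} = measure lebesgue ({x..y} \<inter> U) + measure lebesgue ({x..y} - U)"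
      using measure_Un2[of "{x..y} \<inter> U" lebesgue "{x..y}"] lmU[of x y]
      by (simp add: Un_absorb1 Diff_Int)
    then show ?thesis using dens[OF True] True by (simp add: algebra_simps)
  next
    case False
    have "measure lebesgue ({x..y} - U) \<le> measure lebesgue {x..y}"
      using U by (intro measure_mono_fmeasurable) auto
    moreover have "measure lebesgue {x..y} = 0" using False by (cases "x = y") auto
    ultimately show ?thesis by (simp only: mult_zero_right)
  qed
  have c1: "c \<le> 1"
  proof -
    have "c * (1 - 0) \<le> measure lebesgue ({0..1::real} \<inter> U)" by (rule dens) simp
    also have "\<dots> \<le> measure lebesgue {0..1::real}"
      using U by (intro measure_mono_fmeasurable) auto
    finally show ?thesis by simp
  qed
  define S where "S = - U \<inter> cbox a b"
  have Seq: "S = {a..b} - U" by (auto simp: S_def)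
  have S: "S \<in> lmeasurable" unfolding Seq by (rule lmU)
  show "negligible S"
  proof (rule ccontr)
    assume "\<not> negligible S"
    then have m: "0 < measure lebesgue S"
      using S by (metis negligible_iff_measure zero_less_measure_iff)
    \<comment> \<open>With this \<open>e\<close> the final bound
      \<open>(1 - c) * (measure lebesgue S + e) + e\<close> is at most
      \<open>measure lebesgue S - 2 * e\<close>.\<close>
    define e where "e = c * measure lebesgue S / 4"
    have e: "0 < e" using c m by (simp add: e_def)
    obtain \<D> where D: "countable \<D>"
        "\<And>K. K \<in> \<D> \<Longrightarrow> K \<subseteq> cbox a b \<and> K \<noteq> {} \<and> (\<exists>c d. K = cbox c d)"
        "pairwise (\<lambda>A B. interior A \<inter> interior B = {}) \<D>"
        "S \<subseteq> \<Union>\<D>" "\<Union>\<D> \<in> lmeasurable" "measure lebesgue (\<Union>\<D>) \<le> measure lebesgue S + e"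
      by (rule measurable_outer_intervals_bounded[OF S, of a b e]) (use e S_def in auto)
    have Dlm: "K \<in> lmeasurable" if "K \<in> \<D>" for K using D(2)[OF that] by auto
    obtain \<E> where E: "\<E> \<subseteq> \<D>" "finite \<E>" "measure lebesgue (\<Union>\<D>) - e < measure lebesgue (\<Union>\<E>)"
    proof (rule measure_countable_Union_approachable[OF D(1) e])
      show "measure lebesgue (\<Union>D') \<le> measure lebesgue (\<Union>\<D>)" if "D' \<subseteq> \<D>" "finite D'" for D'
        using that Dlm D(5) by (intro measure_mono_fmeasurable) (auto intro!: sets.finite_Union)
    qed (use Dlm in auto)
    have Elm: "\<Union>\<E> \<in> lmeasurable" using E Dlm by (intro fmeasurable.finite_Union) auto
    have Esum: "measure lebesgue (\<Union>\<E>) = (\<Sum>K\<in>\<E>. measure lebesgue K)"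
    proof (rule measure_negligible_finite_Union[OF E(2)])
      show "pairwise (\<lambda>S T. negligible (S \<inter> T)) \<E>"
      proof (rule pairwiseI)
        fix K L assume KL: "K \<in> \<E>" "L \<in> \<E>" "K \<noteq> L"
        then have "interior (K \<inter> L) = {}" using D(3) E(1) by (auto simp: pairwise_def interior_Int)
        moreover have "convex (K \<inter> L)"
        proof -
          obtain c d c' d' where "K = cbox c d" "L = cbox c' d'" using D(2) KL E(1) by (metis subsetD)
          then show ?thesis by (metis convex_Int convex_box(1))
        qed
        ultimately show "negligible (K \<inter> L)" by (simp add: negligible_convex_interior)
      qed
    qed (use E Dlm in auto)
    have "measure lebesgue S \<le> measure lebesgue ((\<Union>K\<in>\<E>. K - U) \<union> (\<Union>\<D> - \<Union>\<E>))"
    proof (rule measure_mono_fmeasurable)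
      show "S \<subseteq> (\<Union>K\<in>\<E>. K - U) \<union> (\<Union>\<D> - \<Union>\<E>)" using D(4) by (auto simp: S_def)
      show "(\<Union>K\<in>\<E>. K - U) \<union> (\<Union>\<D> - \<Union>\<E>) \<in> lmeasurable"
        using E Dlm U D(5) Elm
        by (intro fmeasurable.Un fmeasurable.finite_UN fmeasurable.Diff fmeasurable_Diff) auto
    qed (use S in auto)
    also have "\<dots> \<le> measure lebesgue (\<Union>K\<in>\<E>. K - U) + measure lebesgue (\<Union>\<D> - \<Union>\<E>)"
      using E Dlm U D(5) Elm
      by (intro measure_Un_le sets.Diff sets.finite_UN) (auto dest!: fmeasurableD)
    also have "measure lebesgue (\<Union>K\<in>\<E>. K - U) \<le> (\<Sum>K\<in>\<E>. measure lebesgue (K - U))"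
      using E Dlm U by (intro measure_UNION_le sets.Diff) (auto dest!: fmeasurableD)
    also have "(\<Sum>K\<in>\<E>. measure lebesgue (K - U)) \<le> (\<Sum>K\<in>\<E>. (1 - c) * measure lebesgue K)"
    proof (rule sum_mono)
      fix K assume "K \<in> \<E>"
      then obtain u v where "K = cbox u v" using D(2) E by blast
      then show "measure lebesgue (K - U) \<le> (1 - c) * measure lebesgue K"
        using dens'[of u v] by (simp only: interval_cbox)
    qed
    also have "\<dots> = (1 - c) * measure lebesgue (\<Union>\<E>)" by (simp only: Esum sum_distrib_left)
    also have "\<dots> \<le> (1 - c) * (measure lebesgue S + e)"
    proof (rule mult_left_mono)
      have "measure lebesgue (\<Union>\<E>) \<le> measure lebesgue (\<Union>\<D>)"
        using E Elm D(5) by (intro measure_mono_fmeasurable) (auto dest: fmeasurableD)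
      then show "measure lebesgue (\<Union>\<E>) \<le> measure lebesgue S + e" using D(6) by linarith
    qed (use c1 in simp)
    also have "measure lebesgue (\<Union>\<D> - \<Union>\<E>) = measure lebesgue (\<Union>\<D>) - measure lebesgue (\<Union>\<E>)"
      using E(1) Elm D(5) by (intro measurable_measure_Diff) (auto dest: fmeasurableD)
    finally have "measure lebesgue S \<le> (1 - c) * (measure lebesgue S + e) + e" using E(3) by linarith
    moreover have "(1 - c) * (measure lebesgue S + e) \<le> measure lebesgue S - 4 * e + e"
      using c e by (simp add: e_def algebra_simps)
    ultimately show False using e by linarith
  qed
qed

lemma (in ubiquitous_system) negligible_compl_neighbourhood: "negligible (- neighbourhood T)"
  by (rule negligible_compl_if_locally_dense[OF density_pos _ local_measure_lower])
    (use open_neighbourhood in auto)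

text \<open>The input of mass transference: radii tending to 0 and, for each \<open>T\<close>, full
  measure of the union of the balls from level \<open>T\<close> on. It will be supplied by
  \<open>ubiquitous_system\<close>.\<close>

locale full_limsup =
  fixes P :: "nat \<Rightarrow> real set" and r :: "nat \<Rightarrow> real"
  assumes r_pos: "\<And>t. 0 < r t" and r_lim: "r \<longlonglongrightarrow> 0"
    and full: "\<And>T. negligible (- (\<Union>t\<in>{T..}. \<Union>p\<in>P t. ball p (r t)))"
begin

text \<open>Off a null set, each point of \<open>V\<close> lies in arbitrarily small balls of the
  system inside \<open>V\<close>. Vitali's theorem gives a countable disjoint family that exhausts
  \<open>V\<close> up to measure zero, and finitely many members already have half of its measure. A
  ball is encoded by the pair of its level and its centre.\<close>

lemma vitali_selection:
  assumes V: "open V" "bounded V" and \<eta>: "0 < \<eta>"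
  obtains X where "finite X"
    "\<forall>a\<in>X. T \<le> fst a \<and> snd a \<in> P (fst a) \<and> r (fst a) < \<eta> \<and> ball (snd a) (r (fst a)) \<subseteq> V"
    "pairwise (\<lambda>a b. disjnt (ball (snd a) (r (fst a))) (ball (snd b) (r (fst b)))) X"
    "measure lebesgue V / 2 \<le> (\<Sum>a\<in>X. 2 * r (fst a))"
proof (cases "measure lebesgue V = 0")
  case True
  then show ?thesis by (intro that[of "{}"]) auto
next
  case False
  have Vlm: "V \<in> lmeasurable" using V by (auto intro: bounded_set_imp_lmeasurable)
  define K where "K = {(t, p). T \<le> t \<and> p \<in> P t \<and> r t < \<eta> \<and> ball p (r t) \<subseteq> V}"
  define N where "N = (\<Union>T. - (\<Union>t\<in>{T..}. \<Union>p\<in>P t. ball p (r t)))"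
  have N: "negligible N" unfolding N_def by (intro negligible_countable_Union) (use full in auto)
  let ?B = "\<lambda>a. ball (snd a) (r (fst a))"
  obtain C where C: "countable C" "C \<subseteq> K" "pairwise (\<lambda>i j. disjnt (?B i) (?B j)) C"
      "negligible (V - N - (\<Union>i\<in>C. ?B i))"
  proof (rule Vitali_covering_theorem_balls[of "V - N" K snd "r \<circ> fst"])
    fix x d :: real assume x: "x \<in> V - N" and d: "0 < d"
    \<comment> \<open>Radii will be taken below \<open>e / 2\<close>, so that a ball containing
      \<open>x\<close> lies in \<open>ball x e\<close>, hence in \<open>V\<close>.\<close>
    obtain e where e: "0 < e" "ball x e \<subseteq> V" using V x by (auto simp: open_contains_ball)
    have "\<forall>\<^sub>F t in sequentially. r t < min (min d \<eta>) (e / 2)"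
      using r_lim d \<eta> e by (intro order_tendstoD(2)[of _ 0]) auto
    then obtain T' where T': "\<And>t. t \<ge> T' \<Longrightarrow> r t < min (min d \<eta>) (e / 2)"
      by (auto simp: eventually_sequentially)
    obtain t p where t: "max T T' \<le> t" "p \<in> P t" "x \<in> ball p (r t)"
      using x unfolding N_def by blast
    have "ball p (r t) \<subseteq> ball x e"
    proof
      fix y assume "y \<in> ball p (r t)"
      then show "y \<in> ball x e" using t(3) T'[of t] t(1) by (auto simp: dist_real_def)
    qed
    then have "(t, p) \<in> K" using t e T'[of t] by (auto simp: K_def)
    then show "\<exists>i. i \<in> K \<and> x \<in> ball (snd i) ((r \<circ> fst) i) \<and> (r \<circ> fst) i < d"
      using t T'[of t] by (intro exI[of _ "(t, p)"]) auto
  qed (auto simp: comp_def)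
  let ?U = "\<Union>i\<in>C. ?B i"
  have UV: "?U \<subseteq> V" using C(2) by (fastforce simp: K_def)
  have "negligible (V - ?U)"
    by (rule negligible_subset[of "N \<union> (V - N - ?U)"]) (use C N in auto)
  then have "negligible (V - ?U \<union> (?U - V))" using UV by (simp add: Diff_eq_empty_iff[THEN iffD2])
  then have meas: "measure lebesgue ?U = measure lebesgue V"
    using measure_negligible_symdiff[OF Vlm] by blast
  have "open ?U" by auto
  then have Ulm: "?U \<in> lmeasurable"
    using V(2) UV by (intro bounded_set_imp_lmeasurable) (auto intro: bounded_subset)
  have mpos: "0 < measure lebesgue V / 2" using False by (simp add: zero_less_measure_iff)
  obtain D' where D': "D' \<subseteq> ?B ` C" "finite D'" "measure lebesgue (\<Union>(?B ` C)) - measure lebesgue V / 2 < measure lebesgue (\<Union>D')"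
  proof (rule measure_countable_Union_approachable[OF _ mpos])
    show "countable (?B ` C)" using C by simp
    show "measure lebesgue (\<Union>D') \<le> measure lebesgue ?U" if "D' \<subseteq> ?B ` C" "finite D'" for D'
      using that Ulm by (intro measure_mono_fmeasurable) (auto intro!: sets.finite_Union)
  qed auto
  obtain X where X: "X \<subseteq> C" "finite X" "D' = ?B ` X" using finite_subset_image[OF D'(2,1)] by blast
  show ?thesis
  proof (rule that[OF X(2)])
    show "\<forall>a\<in>X. T \<le> fst a \<and> snd a \<in> P (fst a) \<and> r (fst a) < \<eta> \<and> ?B a \<subseteq> V"
    proof
      fix a assume "a \<in> X"
      then have "a \<in> K" using X(1) C(2) by blast
      then show "T \<le> fst a \<and> snd a \<in> P (fst a) \<and> r (fst a) < \<eta> \<and> ?B a \<subseteq> V"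
        by (auto simp: K_def case_prod_unfold)
    qed
    show "pairwise (\<lambda>a b. disjnt (?B a) (?B b)) X" using C(3) X(1) by (rule pairwise_subset)
    have "measure lebesgue V / 2 \<le> measure lebesgue (\<Union>a\<in>X. ?B a)" using D'(3) meas X by simp
    also have "\<dots> \<le> (\<Sum>a\<in>X. measure lebesgue (?B a))"
      using X(2) by (intro measure_UNION_le) auto
    also have "\<dots> = (\<Sum>a\<in>X. 2 * r (fst a))"
      by (simp only: measure_lebesgue_ball_real[OF less_imp_le[OF r_pos]])
    finally show "measure lebesgue V / 2 \<le> (\<Sum>a\<in>X. 2 * r (fst a))" .
  qed
qed

lemma sum_disjoint_radii_le:
  fixes X :: "(nat \<times> real) set"
  assumes fin: "finite X" and e: "0 \<le> e"
    and disj: "pairwise (\<lambda>a b. disjnt (ball (snd a) (r (fst a))) (ball (snd b) (r (fst b)))) X"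
    and sub: "\<And>a. a \<in> X \<Longrightarrow> ball (snd a) (r (fst a)) \<subseteq> cball c e"
  shows "(\<Sum>a\<in>X. r (fst a)) \<le> e"
proof -
  let ?B = "\<lambda>a. ball (snd a) (r (fst a))"
  have "2 * (\<Sum>a\<in>X. r (fst a)) = (\<Sum>a\<in>X. measure lebesgue (?B a))"
    by (simp only: measure_lebesgue_ball_real[OF less_imp_le[OF r_pos]] sum_distrib_left)
  also have "\<dots> = measure lebesgue (\<Union>a\<in>X. ?B a)"
    using fin disj by (intro measure_negligible_finite_Union_image[symmetric])
      (auto simp: pairwise_def disjnt_def)
  also have "\<dots> \<le> measure lebesgue (cball c e)"
    using fin sub by (intro measure_mono_fmeasurable) auto
  also have "\<dots> = 2 * e" using e by (simp add: cball_eq_atLeastAtMost)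
  finally show ?thesis by simp
qed

end

section \<open>Mass transference\<close>

context full_limsup
begin

text \<open>Each layer is a Vitali family of disjoint intervals of radius \<open>r t\<close> that avoids the intervals
  of radius \<open>3 \<delta> t\<close> around the centres of earlier layers. Covering sets longer than half of
  the interval that they meet have small total length, so after discarding the intervals met by
  them every covering set meets at most one shrunken interval of all layers together, while the total
  length of the unshrunken intervals grows linearly with the number of layers.\<close>

lemma layers:
  fixes U :: "nat \<Rightarrow> real set" and d \<delta> :: "nat \<Rightarrow> real" and L T :: nat
  assumes \<beta>: "0 < \<beta>" and d: "\<And>k. 0 < d k"
    and diam: "\<forall>k. \<forall>u\<in>U k. \<forall>v\<in>U k. \<bar>u - v\<bar> \<le> d k"
    and small: "\<forall>F. finite F \<longrightarrow> (\<forall>k\<in>F. U k \<inter> ball c \<beta> \<noteq> {}) \<longrightarrow> (\<Sum>k\<in>F. d k) \<le> \<beta> / 40"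
    and L: "1 \<le> L" and \<delta>: "\<forall>t\<ge>T. 0 < \<delta> t \<and> 6 * real L * \<delta> t \<le> r t"
    and l: "l \<le> L"
  shows "\<exists>X. finite X \<and>
    (\<forall>a\<in>X. T \<le> fst a \<and> snd a \<in> P (fst a) \<and> ball (snd a) (r (fst a)) \<subseteq> ball c \<beta> \<and>
       (\<forall>k. U k \<inter> cball (snd a) (\<delta> (fst a)) \<noteq> {} \<longrightarrow> d k < r (fst a) / 2)) \<and>
    (\<forall>a\<in>X. \<forall>b\<in>X. \<forall>k. U k \<inter> cball (snd a) (\<delta> (fst a)) \<noteq> {} \<longrightarrow>
       U k \<inter> cball (snd b) (\<delta> (fst b)) \<noteq> {} \<longrightarrow> a = b) \<and>
    real l * \<beta> / 8 \<le> (\<Sum>a\<in>X. r (fst a)) \<and> (\<Sum>a\<in>X. r (fst a)) \<le> real l * \<beta>"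
  using l
proof (induction l)
  case 0
  show ?case by (intro exI[of _ "{}"]) auto
next
  case (Suc l)
  let ?B = "\<lambda>a. ball (snd a) (r (fst a))"
  let ?C = "\<lambda>a. cball (snd a) (\<delta> (fst a))"
  have "l \<le> L" using Suc.prems by simp
  from Suc.IH[OF this] obtain X where X': "finite X"
    "\<forall>a\<in>X. T \<le> fst a \<and> snd a \<in> P (fst a) \<and> ?B a \<subseteq> ball c \<beta> \<and>
       (\<forall>k. U k \<inter> ?C a \<noteq> {} \<longrightarrow> d k < r (fst a) / 2)"
    "\<forall>a\<in>X. \<forall>b\<in>X. \<forall>k. U k \<inter> ?C a \<noteq> {} \<longrightarrow> U k \<inter> ?C b \<noteq> {} \<longrightarrow> a = b"
    "real l * \<beta> / 8 \<le> (\<Sum>a\<in>X. r (fst a))" "(\<Sum>a\<in>X. r (fst a)) \<le> real l * \<beta>"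
    by (elim exE conjE) (rule that; assumption)
  have X: "finite X"
    "\<And>a. a \<in> X \<Longrightarrow> T \<le> fst a \<and> snd a \<in> P (fst a) \<and> ?B a \<subseteq> ball c \<beta> \<and>
       (\<forall>k. U k \<inter> ?C a \<noteq> {} \<longrightarrow> d k < r (fst a) / 2)"
    "\<And>a b k. a \<in> X \<Longrightarrow> b \<in> X \<Longrightarrow> U k \<inter> ?C a \<noteq> {} \<Longrightarrow> U k \<inter> ?C b \<noteq> {} \<Longrightarrow> a = b"
    "real l * \<beta> / 8 \<le> (\<Sum>a\<in>X. r (fst a))" "(\<Sum>a\<in>X. r (fst a)) \<le> real l * \<beta>"
    using X'(1) X'(4,5) bspec[OF X'(2)] X'(3) by (assumption | blast)+
  have \<delta>: "0 < \<delta> t \<and> 6 * real L * \<delta> t \<le> r t" if "T \<le> t" for t using \<delta> that by blast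
  have \<delta>6: "6 * \<delta> t \<le> r t" if "T \<le> t" for t
  proof -
    have "1 * \<delta> t \<le> real L * \<delta> t" using \<delta>[OF that] L by (intro mult_right_mono) auto
    then show ?thesis using \<delta>[OF that] by linarith
  qed
  define V where "V = ball c \<beta> - (\<Union>a\<in>X. cball (snd a) (3 * \<delta> (fst a)))"
  have V: "open V" "bounded V"
    unfolding V_def using X(1) by (auto intro!: open_Diff closed_UN intro: bounded_subset[OF bounded_ball])
  \<comment> \<open>By the ratio \<open>6 * L\<close> between \<open>r\<close> and
    \<open>\<delta>\<close>, the removed balls have total length at most
    \<open>l * \<beta> / L\<close>, hence at most half of \<open>2 * \<beta>\<close>.\<close>
  have Vmeas: "\<beta> \<le> measure lebesgue V"
  proof -
    let ?E = "\<Union>a\<in>X. cball (snd a) (3 * \<delta> (fst a))"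
    have "measure lebesgue (ball c \<beta>) \<le> measure lebesgue (V \<union> ?E)"
      using X(1) V by (intro measure_mono_fmeasurable fmeasurable.Un fmeasurable.finite_UN
          bounded_set_imp_lmeasurable) (auto simp: V_def)
    also have "\<dots> \<le> measure lebesgue V + measure lebesgue ?E"
      using X(1) V by (intro measure_Un_le sets.finite_UN) auto
    also have "measure lebesgue ?E \<le> (\<Sum>a\<in>X. measure lebesgue (cball (snd a) (3 * \<delta> (fst a))))"
      using X(1) by (intro measure_UNION_le) auto
    also have "\<dots> \<le> (\<Sum>a\<in>X. r (fst a) / real L)"
    proof (rule sum_mono)
      fix a assume "a \<in> X"
      then have "T \<le> fst a" using X(2) by blast
      then show "measure lebesgue (cball (snd a) (3 * \<delta> (fst a))) \<le> r (fst a) / real L"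
        using \<delta>[of "fst a"] L by (simp add: cball_eq_atLeastAtMost field_simps)
    qed
    also have "\<dots> = (\<Sum>a\<in>X. r (fst a)) / real L" by (simp add: sum_divide_distrib)
    also have "\<dots> \<le> real l * \<beta> / real L" using X(5) by (intro divide_right_mono) auto
    also have "\<dots> \<le> \<beta>"
    proof -
      have "real l * \<beta> \<le> real L * \<beta>" using Suc.prems \<beta> by (intro mult_right_mono) auto
      then show ?thesis using L by (simp add: field_simps)
    qed
    finally show ?thesis using measure_lebesgue_ball_real[of \<beta> c] \<beta> by linarith
  qed
  \<comment> \<open>New radii stay below every earlier \<open>\<delta>\<close>, as
    \<open>cross\<close> needs; the inserted 1 keeps \<open>Min\<close> meaningful when
    \<open>X\<close> is empty.\<close>
  define \<eta> where "\<eta> = Min (insert 1 ((\<lambda>a. \<delta> (fst a)) ` X))"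
  have \<eta>: "0 < \<eta>" "\<And>a. a \<in> X \<Longrightarrow> \<eta> \<le> \<delta> (fst a)"
    using X(1) X(2) \<delta> by (auto simp: \<eta>_def Min_gr_iff)
  obtain Y where Y: "finite Y"
    "\<forall>a\<in>Y. T \<le> fst a \<and> snd a \<in> P (fst a) \<and> r (fst a) < \<eta> \<and> ?B a \<subseteq> V"
    "pairwise (\<lambda>a b. disjnt (?B a) (?B b)) Y"
    "measure lebesgue V / 2 \<le> (\<Sum>a\<in>Y. 2 * r (fst a))"
    by (rule vitali_selection[OF V \<eta>(1), of T])
  have Y2: "T \<le> fst a" "snd a \<in> P (fst a)" "r (fst a) < \<eta>" "?B a \<subseteq> V" "?B a \<subseteq> ball c \<beta>"
    if "a \<in> Y" for a
    using bspec[OF Y(2) that] by (auto simp: V_def)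
  have CB: "?C a \<subseteq> ?B a" if "T \<le> fst a" for a
    using \<delta>6[OF that] \<delta>[OF that] by auto
  define good where "good a \<longleftrightarrow> (\<forall>k. U k \<inter> ?C a \<noteq> {} \<longrightarrow> d k < r (fst a) / 2)" for a
  define Yb where "Yb = {a \<in> Y. \<not> good a}"
  define Yg where "Yg = {a \<in> Y. good a}"
  have fin: "finite Yb" "finite Yg" using Y(1) by (auto simp: Yb_def Yg_def)
  \<comment> \<open>A discarded ball has a witness \<open>\<kappa> a\<close> with
    \<open>d (\<kappa> a)\<close> at least half its radius. Disjoint balls with the same witness
    \<open>k\<close> lie within \<open>5 * d k\<close> of a point of \<open>U k\<close>, so their
    radii sum to at most \<open>5 * d k\<close>, and \<open>small\<close> bounds the total by
    \<open>5 * (\<beta> / 40)\<close>.\<close>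
  have bad: "(\<Sum>a\<in>Yb. r (fst a)) \<le> \<beta> / 8"
  proof -
    have "\<exists>k. U k \<inter> ?C a \<noteq> {} \<and> r (fst a) / 2 \<le> d k" if "a \<in> Yb" for a
      using that by (auto simp: Yb_def good_def not_less)
    then obtain \<kappa> where \<kappa>: "\<And>a. a \<in> Yb \<Longrightarrow> U (\<kappa> a) \<inter> ?C a \<noteq> {} \<and> r (fst a) / 2 \<le> d (\<kappa> a)"
      by metis
    have "(\<Sum>a\<in>Yb. r (fst a)) = (\<Sum>k\<in>\<kappa> ` Yb. \<Sum>a\<in>{a \<in> Yb. \<kappa> a = k}. r (fst a))"
      using fin(1) by (rule sum.image_gen)
    also have "\<dots> \<le> (\<Sum>k\<in>\<kappa> ` Yb. 5 * d k)"
    proof (rule sum_mono)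
      fix k assume "k \<in> \<kappa> ` Yb"
      then obtain u where u: "u \<in> U k" using \<kappa> by fastforce
      show "(\<Sum>a\<in>{a \<in> Yb. \<kappa> a = k}. r (fst a)) \<le> 5 * d k"
      proof (rule sum_disjoint_radii_le)
        show "finite {a \<in> Yb. \<kappa> a = k}" using fin by simp
        show "0 \<le> 5 * d k" using d[of k] by simp
        show "pairwise (\<lambda>a b. disjnt (?B a) (?B b)) {a \<in> Yb. \<kappa> a = k}"
          by (rule pairwise_subset[OF Y(3)]) (auto simp: Yb_def)
        fix a assume a: "a \<in> {a \<in> Yb. \<kappa> a = k}"
        then obtain v where v: "v \<in> U k" "\<bar>snd a - v\<bar> \<le> \<delta> (fst a)"
          using \<kappa>[of a] by (auto simp: dist_real_def)
        have "T \<le> fst a" using a Y2 by (auto simp: Yb_def)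
        then have "6 * \<delta> (fst a) \<le> r (fst a)" by (rule \<delta>6)
        moreover have "r (fst a) \<le> 2 * d k" using \<kappa>[of a] a by auto
        moreover have "\<bar>u - v\<bar> \<le> d k" using u v(1) by (intro diam[rule_format])
        ultimately show "?B a \<subseteq> cball u (5 * d k)"
          using v(2) d[of k] by (auto simp: dist_real_def)
      qed
    qed
    also have "\<dots> = 5 * (\<Sum>k\<in>\<kappa> ` Yb. d k)" by (simp add: sum_distrib_left)
    also have "(\<Sum>k\<in>\<kappa> ` Yb. d k) \<le> \<beta> / 40"
    proof (rule small[rule_format])
      fix k assume "k \<in> \<kappa> ` Yb"
      then obtain a where a: "a \<in> Yb" "k = \<kappa> a" by auto
      then have "a \<in> Y" by (simp add: Yb_def)
      then have "?C a \<subseteq> ball c \<beta>" using CB Y2 by blast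
      then show "U k \<inter> ball c \<beta> \<noteq> {}" using \<kappa>[OF a(1)] a(2) by blast
    qed (use fin in simp)
    finally show ?thesis by simp
  qed
  have "(\<Sum>a\<in>Y. r (fst a)) = (\<Sum>a\<in>Yg. r (fst a)) + (\<Sum>a\<in>Yb. r (fst a))"
    using Y(1) by (subst sum.union_disjoint[symmetric]) (auto simp: Yg_def Yb_def intro!: sum.cong)
  moreover have "\<beta> / 4 \<le> (\<Sum>a\<in>Y. r (fst a))"
    using Y(4) Vmeas by (simp add: sum_distrib_left[symmetric])
  ultimately have Yg_lower: "\<beta> / 8 \<le> (\<Sum>a\<in>Yg. r (fst a))" using bad by linarith
  have Yg_upper: "(\<Sum>a\<in>Yg. r (fst a)) \<le> \<beta>"
  proof (rule sum_disjoint_radii_le[where c = c])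
    show "pairwise (\<lambda>a b. disjnt (?B a) (?B b)) Yg"
      by (rule pairwise_subset[OF Y(3)]) (auto simp: Yg_def)
    show "?B a \<subseteq> cball c \<beta>" if "a \<in> Yg" for a
      using Y2(5)[of a] that by (auto simp: Yg_def)
  qed (use fin \<beta> in auto)
  \<comment> \<open>A set \<open>U k\<close> that meets both shrunken balls is shorter than half of
    \<open>\<delta> (fst a)\<close>, yet it would have to lead from within
    \<open>\<delta> (fst a)\<close> of the centre to beyond
    \<open>3 * \<delta> (fst a)\<close>.\<close>
  have cross: False if a: "a \<in> X" and b: "b \<in> Yg" and k: "U k \<inter> ?C a \<noteq> {}" "U k \<inter> ?C b \<noteq> {}" for a b k
  proof -
    obtain u v where uv: "u \<in> U k" "\<bar>snd a - u\<bar> \<le> \<delta> (fst a)" "v \<in> U k" "v \<in> ?C b"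
      using k by (auto simp: dist_real_def)
    have bY: "b \<in> Y" using b by (simp add: Yg_def)
    then have "v \<in> V" using uv(4) CB Y2 by blast
    then have "3 * \<delta> (fst a) < \<bar>snd a - v\<bar>" using a by (auto simp: V_def dist_real_def)
    moreover have "\<bar>u - v\<bar> \<le> d k" using uv by (intro diam[rule_format])
    moreover have "d k < r (fst b) / 2" using b k(2) by (simp add: Yg_def good_def)
    moreover have "r (fst b) < \<delta> (fst a)" using Y2(3)[OF bY] \<eta>(2)[OF a] by linarith
    moreover have "0 < r (fst b)" by (rule r_pos)
    ultimately show False using uv(2) by linarith
  qed
  \<comment> \<open>\<open>U k\<close> is shorter than half the radius of \<open>a\<close> and comes
    within a sixth of that radius of its centre, so \<open>v\<close> lies in both of the disjoint
    unshrunken balls.\<close>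
  have same: "a = b" if ab: "a \<in> Yg" "b \<in> Yg" and k: "U k \<inter> ?C a \<noteq> {}" "U k \<inter> ?C b \<noteq> {}" for a b k
  proof (rule ccontr)
    assume "a \<noteq> b"
    obtain u v where uv: "u \<in> U k" "\<bar>snd a - u\<bar> \<le> \<delta> (fst a)" "v \<in> U k" "v \<in> ?C b"
      using k by (auto simp: dist_real_def)
    have Y': "a \<in> Y" "b \<in> Y" using ab by (auto simp: Yg_def)
    then have "v \<in> ?B b" using uv(4) CB Y2 by blast
    moreover have "v \<in> ?B a"
    proof -
      have "\<bar>u - v\<bar> \<le> d k" using uv by (intro diam[rule_format])
      moreover have "d k < r (fst a) / 2" using ab k by (simp add: Yg_def good_def)
      moreover have "6 * \<delta> (fst a) \<le> r (fst a)" using Y2 Y' by (intro \<delta>6) auto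
      ultimately show ?thesis using uv(2) r_pos[of "fst a"] by (simp add: dist_real_def)
    qed
    ultimately show False using Y(3) Y' \<open>a \<noteq> b\<close> unfolding pairwise_def disjnt_def by blast
  qed
  have disj: "X \<inter> Yg = {}"
  proof (rule ccontr)
    assume "X \<inter> Yg \<noteq> {}"
    then obtain a where a: "a \<in> X" "a \<in> Y" by (auto simp: Yg_def)
    then have "snd a \<in> V" using Y2(4)[of a] r_pos[of "fst a"] by auto
    then show False using a X(2)[OF a(1)] \<delta>[of "fst a"] by (auto simp: V_def)
  qed
  have sumU: "(\<Sum>a\<in>X \<union> Yg. r (fst a)) = (\<Sum>a\<in>X. r (fst a)) + (\<Sum>a\<in>Yg. r (fst a))"
    using X(1) fin disj by (intro sum.union_disjoint) auto
  show ?case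
  proof (intro exI[of _ "X \<union> Yg"] conjI)
    show "\<forall>a\<in>X \<union> Yg. T \<le> fst a \<and> snd a \<in> P (fst a) \<and> ?B a \<subseteq> ball c \<beta> \<and>
       (\<forall>k. U k \<inter> ?C a \<noteq> {} \<longrightarrow> d k < r (fst a) / 2)"
    proof
      fix a assume "a \<in> X \<union> Yg"
      then show "T \<le> fst a \<and> snd a \<in> P (fst a) \<and> ?B a \<subseteq> ball c \<beta> \<and>
          (\<forall>k. U k \<inter> ?C a \<noteq> {} \<longrightarrow> d k < r (fst a) / 2)"
      proof
        assume "a \<in> Yg"
        then have "a \<in> Y" "good a" by (auto simp: Yg_def)
        then show ?thesis using Y2[of a] by (auto simp: good_def)
      qed (rule X(2))
    qed
    show "\<forall>a\<in>X \<union> Yg. \<forall>b\<in>X \<union> Yg. \<forall>k. U k \<inter> ?C a \<noteq> {} \<longrightarrow> U k \<inter> ?C b \<noteq> {} \<longrightarrow> a = b"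
      using X(3) same cross by blast
    show "real (Suc l) * \<beta> / 8 \<le> (\<Sum>a\<in>X \<union> Yg. r (fst a))"
      using sumU X(4) Yg_lower by (simp add: algebra_simps add_divide_distrib)
    show "(\<Sum>a\<in>X \<union> Yg. r (fst a)) \<le> real (Suc l) * \<beta>"
      using sumU X(5) Yg_upper by (simp add: algebra_simps)
  qed (use X fin in auto)
qed

text \<open>A pigeonhole argument on the family from \<open>layers\<close>: no covering set meets
  two of its shrunken balls, so if each of them met sets of cost above
  \<open>\<theta> * r t\<close>, the costs would sum to more than
  \<open>\<theta> * L * \<beta> / 8\<close>, which exceeds \<open>M\<close> by the choice of
  \<open>L\<close>. Here \<open>r t\<close> is the shrunken radius to the power
  \<open>s\<close>.\<close>

lemma next_ball:
  fixes U :: "nat \<Rightarrow> real set" and d :: "nat \<Rightarrow> real"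
  assumes s: "0 < s" "s < 1" and \<beta>: "0 < \<beta>" and \<theta>: "0 < \<theta>" and d: "\<And>k. 0 < d k"
    and diam: "\<forall>k. \<forall>u\<in>U k. \<forall>v\<in>U k. \<bar>u - v\<bar> \<le> d k"
    and small: "\<forall>F. finite F \<longrightarrow> (\<forall>k\<in>F. U k \<inter> ball c \<beta> \<noteq> {}) \<longrightarrow> (\<Sum>k\<in>F. d k) \<le> \<beta> / 40"
    and M: "\<forall>F. finite F \<longrightarrow> (\<forall>k\<in>F. U k \<inter> ball c \<beta> \<noteq> {}) \<longrightarrow> (\<Sum>k\<in>F. d k powr s) \<le> M"
  shows "\<exists>t p. T \<le> t \<and> p \<in> P t \<and> cball p (r t powr (1 / s)) \<subseteq> ball c \<beta> \<and>
    (\<forall>F. finite F \<longrightarrow> (\<forall>k\<in>F. U k \<inter> cball p (r t powr (1 / s)) \<noteq> {}) \<longrightarrow> (\<Sum>k\<in>F. d k powr s) \<le> \<theta> * r t)"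
proof -
  define L where "L = nat \<lceil>\<bar>8 * M / (\<theta> * \<beta>)\<bar>\<rceil> + 1"
  have L: "1 \<le> L" by (simp add: L_def)
  have "8 * M / (\<theta> * \<beta>) < real L" unfolding L_def by linarith
  then have L_large: "M < \<theta> * (real L * \<beta> / 8)" using \<beta> \<theta> by (simp add: field_simps)
  let ?\<delta> = "\<lambda>t. r t powr (1 / s)"
  \<comment> \<open>Shrinking multiplies the radius by \<open>r t powr (1 / s - 1)\<close>, which
    tends to 0 because \<open>s < 1\<close>; fine levels therefore have the ratio
    \<open>6 * L\<close> that \<open>layers\<close> requires.\<close>
  have "(\<lambda>t. r t powr (1 / s - 1)) \<longlonglongrightarrow> 0 powr (1 / s - 1)"
    using s r_lim r_pos by (intro tendsto_powr2 tendsto_const) (auto simp: less_imp_le)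
  then have "(\<lambda>t. r t powr (1 / s - 1)) \<longlonglongrightarrow> 0" by simp
  then have "\<forall>\<^sub>F t in sequentially. r t powr (1 / s - 1) < 1 / (6 * real L)"
    using L by (intro order_tendstoD(2)[of _ 0]) auto
  then have "\<forall>\<^sub>F t in sequentially. T \<le> t \<and> r t powr (1 / s - 1) < 1 / (6 * real L)"
    using eventually_ge_at_top[of T] by eventually_elim auto
  then obtain T' where T': "\<And>t. T' \<le> t \<Longrightarrow> T \<le> t \<and> r t powr (1 / s - 1) < 1 / (6 * real L)"
    by (auto simp: eventually_sequentially)
  have \<delta>: "\<forall>t\<ge>T'. 0 < ?\<delta> t \<and> 6 * real L * ?\<delta> t \<le> r t"
  proof (intro allI impI conjI)
    fix t assume t: "T' \<le> t"
    show "0 < ?\<delta> t" using r_pos[of t] by simp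
    have "?\<delta> t = r t powr (1 / s - 1) * r t" using r_pos[of t] by (simp add: powr_diff)
    also have "\<dots> \<le> 1 / (6 * real L) * r t"
      using T'[OF t] r_pos[of t] by (intro mult_right_mono) auto
    finally show "6 * real L * ?\<delta> t \<le> r t" using L by (simp add: field_simps)
  qed
  let ?C = "\<lambda>a. cball (snd a) (?\<delta> (fst a))"
  obtain X where X': "finite X"
    "\<forall>a\<in>X. T' \<le> fst a \<and> snd a \<in> P (fst a) \<and> ball (snd a) (r (fst a)) \<subseteq> ball c \<beta> \<and>
       (\<forall>k. U k \<inter> ?C a \<noteq> {} \<longrightarrow> d k < r (fst a) / 2)"
    "\<forall>a\<in>X. \<forall>b\<in>X. \<forall>k. U k \<inter> ?C a \<noteq> {} \<longrightarrow> U k \<inter> ?C b \<noteq> {} \<longrightarrow> a = b"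
    "real L * \<beta> / 8 \<le> (\<Sum>a\<in>X. r (fst a))"
    using layers[where U = U and d = d and \<delta> = ?\<delta> and c = c and \<beta> = \<beta>, OF \<beta> d diam small L \<delta> order_refl]
    by (elim exE conjE) (rule that; assumption)
  have X: "finite X"
    "\<And>a. a \<in> X \<Longrightarrow> T' \<le> fst a \<and> snd a \<in> P (fst a) \<and> ball (snd a) (r (fst a)) \<subseteq> ball c \<beta>"
    "\<And>a b k. a \<in> X \<Longrightarrow> b \<in> X \<Longrightarrow> U k \<inter> ?C a \<noteq> {} \<Longrightarrow> U k \<inter> ?C b \<noteq> {} \<Longrightarrow> a = b"
    "real L * \<beta> / 8 \<le> (\<Sum>a\<in>X. r (fst a))"
    using X'(1,4) bspec[OF X'(2)] X'(3) by (assumption | blast)+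
  have sub: "?C a \<subseteq> ball c \<beta>" if "a \<in> X" for a
  proof -
    have "6 * real L * ?\<delta> (fst a) \<le> r (fst a)" "0 < ?\<delta> (fst a)" using \<delta> X(2)[OF that] by blast+
    moreover have "1 * ?\<delta> (fst a) \<le> real L * ?\<delta> (fst a)" using L by (intro mult_right_mono) auto
    ultimately have "?\<delta> (fst a) < r (fst a)" by linarith
    then have "?C a \<subseteq> ball (snd a) (r (fst a))" by auto
    then show ?thesis using X(2)[OF that] by blast
  qed
  show ?thesis
  proof (rule ccontr)
    assume no: "\<not> ?thesis"
    have "\<exists>F. finite F \<and> (\<forall>k\<in>F. U k \<inter> ?C a \<noteq> {}) \<and> \<theta> * r (fst a) < (\<Sum>k\<in>F. d k powr s)" if "a \<in> X" for a
      using no X(2)[OF that] sub[OF that] T'[of "fst a"] by (meson not_le)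
    then obtain F where F: "\<And>a. a \<in> X \<Longrightarrow> finite (F a) \<and> (\<forall>k\<in>F a. U k \<inter> ?C a \<noteq> {}) \<and> \<theta> * r (fst a) < (\<Sum>k\<in>F a. d k powr s)"
      by metis
    have disj: "F a \<inter> F b = {}" if "a \<in> X" "b \<in> X" "a \<noteq> b" for a b
      using X(3)[OF that(1,2)] F that by blast
    have "\<theta> * (real L * \<beta> / 8) \<le> \<theta> * (\<Sum>a\<in>X. r (fst a))" using X(4) \<theta> by (intro mult_left_mono) auto
    also have "\<dots> = (\<Sum>a\<in>X. \<theta> * r (fst a))" by (rule sum_distrib_left)
    also have "\<dots> \<le> (\<Sum>a\<in>X. \<Sum>k\<in>F a. d k powr s)" using F by (intro sum_mono) (auto intro: less_imp_le)
    also have "\<dots> = (\<Sum>k\<in>(\<Union>a\<in>X. F a). d k powr s)"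
      using X(1) F disj by (intro sum.UNION_disjoint[symmetric]) blast+
    also have "\<dots> \<le> M"
    proof (rule M[rule_format])
      show "U k \<inter> ball c \<beta> \<noteq> {}" if "k \<in> (\<Union>a\<in>X. F a)" for k
      proof -
        obtain a where "a \<in> X" "k \<in> F a" using \<open>k \<in> _\<close> by blast
        then have "U k \<inter> ?C a \<noteq> {}" "?C a \<subseteq> ball c \<beta>" using F sub by blast+
        then show ?thesis by blast
      qed
    qed (use X(1) F in auto)
    finally show False using L_large by linarith
  qed
qed

end

section \<open>Elementary properties of Hausdorff measure\<close>

lemma hausdorff_cost_pos_exponent:
  "0 < s \<Longrightarrow> hausdorff_cost s U = ennreal (diameter U powr s)"
  by (simp add: hausdorff_cost_def)

lemma hausdorff_measure_mono:
  assumes "A \<subseteq> B"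
  shows "hausdorff_measure s A \<le> hausdorff_measure s B"
proof -
  have "hausdorff_premeasure s \<delta> A \<le> hausdorff_premeasure s \<delta> B" for \<delta>
    unfolding hausdorff_premeasure_def by (rule INF_superset_mono) (use assms in auto)
  then show ?thesis
    unfolding hausdorff_measure_def by (rule SUP_mono')
qed

text \<open>The Hausdorff-Cantelli lemma: every tail of the family covers \<open>A\<close>, and the
  tails have arbitrarily small diameters and cost.\<close>

lemma hausdorff_measure_limsup_eq_0:
  fixes V :: "nat \<Rightarrow> nat \<Rightarrow> 'a::metric_space set"
  assumes s: "0 < s" and bdd: "\<And>q a. bounded (V q a)"
    and A: "\<And>x. x \<in> A \<Longrightarrow> infinite {q. \<exists>a\<le>n q. x \<in> V q a}"
    and sm: "summable (\<lambda>q. \<Sum>a\<le>n q. diameter (V q a) powr s)"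
  shows "hausdorff_measure s A = 0"
proof -
  define h where "h q = (\<Sum>a\<le>n q. diameter (V q a) powr s)" for q
  have h0: "0 \<le> h q" for q unfolding h_def by (intro sum_nonneg) auto
  have sm': "summable h" using sm by (simp add: h_def[abs_def])
  have pre: "hausdorff_premeasure s \<delta> A \<le> 0 + ennreal \<epsilon>" if \<delta>: "0 < \<delta>" and \<epsilon>: "0 < \<epsilon>" for \<delta> \<epsilon>
  proof -
    have "h \<longlonglongrightarrow> 0" using sm' by (rule summable_LIMSEQ_zero)
    then have "\<forall>\<^sub>F q in sequentially. h q < \<delta> powr s"
      using \<delta> by (intro order_tendstoD(2)[of _ 0]) auto
    then obtain Q1 where Q1: "\<And>q. Q1 \<le> q \<Longrightarrow> h q < \<delta> powr s" by (auto simp: eventually_sequentially)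
    obtain Q2 where Q2: "\<And>m. Q2 \<le> m \<Longrightarrow> norm (\<Sum>i. h (i + m)) < \<epsilon>"
      using suminf_exist_split[OF \<epsilon> sm'] by blast
    define Q where "Q = max Q1 Q2"
    \<comment> \<open>Padding with \<open>{}\<close>, whose cost is 0, turns the tail into a family
      over all pairs, which \<open>prod_decode\<close> arranges as a sequence.\<close>
    define W where "W = (\<lambda>(q, a). if Q \<le> q \<and> a \<le> n q then V q a else {})"
    have diamW: "diameter (W (q, a)) \<le> \<delta>" for q a
    proof (cases "Q \<le> q \<and> a \<le> n q")
      case True
      have "diameter (V q a) powr s \<le> h q"
        unfolding h_def using True by (intro member_le_sum) auto
      also have "\<dots> < \<delta> powr s" using Q1 True by (simp add: Q_def)
      finally have "diameter (V q a) \<le> \<delta>"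
        using s \<delta> by (meson less_imp_le linorder_not_le powr_less_mono2 diameter_ge_0 bdd less_asym)
      then show ?thesis using True by (simp add: W_def)
    qed (use \<delta> in \<open>auto simp: W_def\<close>)
    have cover: "A \<subseteq> (\<Union>k. W (prod_decode k))"
    proof
      fix x assume "x \<in> A"
      then have "infinite {q. \<exists>a\<le>n q. x \<in> V q a}" by (rule A)
      then obtain q a where "Q \<le> q" "a \<le> n q" "x \<in> V q a" unfolding infinite_nat_iff_unbounded_le by blast
      then have "x \<in> W (prod_decode (prod_encode (q, a)))" by (simp add: W_def)
      then show "x \<in> (\<Union>k. W (prod_decode k))" by blast
    qed
    define g where "g q = (if Q \<le> q then h q else 0)" for q
    have g0: "0 \<le> g q" for q by (simp add: g_def h0)
    have gsum: "summable g" by (rule summable_comparison_test[OF _ sm']) (auto simp: g_def h0)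
    have "hausdorff_premeasure s \<delta> A \<le> (\<Sum>k. hausdorff_cost s (W (prod_decode k)))"
      unfolding hausdorff_premeasure_def
    proof (rule INF_lower, safe)
      fix k
      obtain q a where "prod_decode k = (q, a)" by fastforce
      then show "bounded (W (prod_decode k))" "diameter (W (prod_decode k)) \<le> \<delta>"
        using diamW bdd by (auto simp: W_def)
    qed (use cover in auto)
    also have "\<dots> = (\<Sum>q. \<Sum>a. hausdorff_cost s (W (q, a)))"
      by (rule suminf_ennreal_2dimen) simp
    also have "\<dots> \<le> (\<Sum>q. ennreal (g q))"
    proof (rule suminf_le)
      fix q
      have "(\<Sum>a. hausdorff_cost s (W (q, a))) = (\<Sum>a\<le>n q. hausdorff_cost s (W (q, a)))"
        by (rule suminf_finite) (auto simp: W_def hausdorff_cost_def)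
      also have "\<dots> \<le> ennreal (g q)"
      proof (cases "Q \<le> q")
        case True
        then have "(\<Sum>a\<le>n q. hausdorff_cost s (W (q, a))) = (\<Sum>a\<le>n q. ennreal (diameter (V q a) powr s))"
          by (intro sum.cong) (auto simp: W_def hausdorff_cost_pos_exponent[OF s])
        also have "\<dots> = ennreal (h q)" unfolding h_def by (rule sum_ennreal) auto
        finally show ?thesis using True by (simp add: g_def)
      qed (simp add: W_def hausdorff_cost_def)
      finally show "(\<Sum>a. hausdorff_cost s (W (q, a))) \<le> ennreal (g q)" .
    qed auto
    also have "\<dots> = ennreal (\<Sum>q. g q)"
      by (rule suminf_ennreal2) (use gsum in \<open>simp_all add: g0\<close>)
    also have "(\<Sum>q. g q) = (\<Sum>q. h (q + Q))"
    proof -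
      have "(\<Sum>q<Q. g q) = 0" "\<And>q. g (q + Q) = h (q + Q)" by (simp_all add: g_def)
      then show ?thesis using suminf_split_initial_segment[OF gsum, of Q] by simp
    qed
    also have "ennreal (\<Sum>q. h (q + Q)) \<le> ennreal \<epsilon>"
      using Q2[of Q] by (intro ennreal_leI) (auto simp: Q_def)
    finally show ?thesis by simp
  qed
  have "hausdorff_premeasure s \<delta> A \<le> 0" if "0 < \<delta>" for \<delta>
    by (rule ennreal_le_epsilon) (rule pre[OF that])
  then have "hausdorff_measure s A \<le> 0"
    unfolding hausdorff_measure_def by (intro SUP_least) auto
  then show ?thesis by simp
qed

text \<open>Each covering set may be enlarged to the interval from its infimum to its supremum,
  whose length is at most the diameter; countable subadditivity then bounds every cover. Passing to
  a measurable subset \<open>B\<close> allows an arbitrary set \<open>A\<close>.\<close>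

lemma emeasure_le_hausdorff_measure_1:
  fixes A B :: "real set"
  assumes B: "B \<in> sets lebesgue" "B \<subseteq> A"
  shows "emeasure lebesgue B \<le> hausdorff_measure 1 A"
proof -
  have "emeasure lebesgue B \<le> hausdorff_premeasure 1 1 A"
    unfolding hausdorff_premeasure_def
  proof (rule INF_greatest, clarify)
    fix U :: "nat \<Rightarrow> real set"
    assume cov: "A \<subseteq> (\<Union>k. U k)" and U: "\<forall>k. bounded (U k) \<and> diameter (U k) \<le> 1"
    define J where "J k = (if U k = {} then {} else {Inf (U k)..Sup (U k)})" for k
    have "U k \<subseteq> J k" for k
    proof -
      have "bdd_below (U k)" "bdd_above (U k)"
        using U by (auto intro: bounded_imp_bdd_above bounded_imp_bdd_below)
      then show ?thesis by (auto simp: J_def intro: cInf_lower cSup_upper)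
    qed
    then have "(\<Union>k. U k) \<subseteq> (\<Union>k. J k)" by (intro UN_mono) auto
    with B(2) cov have "B \<subseteq> (\<Union>k. J k)" by (meson order_trans)
    then have "emeasure lebesgue B \<le> emeasure lebesgue (\<Union>k. J k)"
      by (rule emeasure_mono) (auto simp: J_def)
    also have "\<dots> \<le> (\<Sum>k. emeasure lebesgue (J k))"
      by (rule emeasure_subadditive_countably) (auto simp: J_def)
    also have "\<dots> \<le> (\<Sum>k. hausdorff_cost 1 (U k))"
    proof (rule suminf_le)
      fix k
      show "emeasure lebesgue (J k) \<le> hausdorff_cost 1 (U k)"
      proof (cases "U k = {}")
        case False
        have b: "bdd_below (U k)" "bdd_above (U k)" "bounded (U k)"
          using U by (auto intro: bounded_imp_bdd_above bounded_imp_bdd_below)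
        have "dist (Sup (U k)) (Inf (U k)) \<le> diameter (closure (U k))"
          using False b by (intro diameter_bounded_bound closure_contains_Sup closure_contains_Inf) auto
        also have "\<dots> = diameter (U k)" using b by (simp add: diameter_closure)
        finally have "Sup (U k) - Inf (U k) \<le> diameter (U k)" by (simp add: dist_real_def)
        moreover have "Inf (U k) \<le> Sup (U k)" using False b by (intro cInf_le_cSup)
        ultimately show ?thesis
          using False b(3) by (simp add: J_def hausdorff_cost_def diameter_ge_0 ennreal_leI)
      qed (simp add: J_def)
    qed auto
    finally show "emeasure lebesgue B \<le> (\<Sum>k. hausdorff_cost 1 (U k))" .
  qed
  also have "\<dots> \<le> hausdorff_measure 1 A"
    unfolding hausdorff_measure_def by (rule SUP_upper) simp
  finally show ?thesis .
qed

text \<open>Cut the interval into \<open>n\<close> equal pieces with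
  \<open>1 / n \<le> \<delta>\<close>. This upper bound closes the chain of inequalities for
  \<open>s = 1\<close> in \<open>divergence\<close>.\<close>

lemma hausdorff_measure_1_unit_interval_le: "hausdorff_measure 1 {0..<1::real} \<le> 1"
  unfolding hausdorff_measure_def
proof (rule SUP_least)
  fix \<delta> :: real assume "\<delta> \<in> {0<..}"
  then have \<delta>: "0 < \<delta>" by simp
  obtain n :: nat where n: "1 / \<delta> < real n" using reals_Archimedean2 by blast
  have n0: "0 < n" using n \<delta> by (cases n) (auto simp: divide_less_0_iff)
  define U where "U k = (if k < n then {real k / real n..real (Suc k) / real n} else {})" for k
  have cover: "{0..<1} \<subseteq> (\<Union>k. U k)"
  proof
    fix x :: real assume x: "x \<in> {0..<1}"
    define k where "k = nat \<lfloor>x * real n\<rfloor>"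
    have k: "real k \<le> x * real n" "x * real n < real k + 1"
      using x unfolding k_def by (auto simp: of_nat_nat)
    have "x * real n < real n" using x n0 by simp
    then have "k < n" using k by linarith
    then have "x \<in> U k" using k n0 by (simp add: U_def field_simps)
    then show "x \<in> (\<Union>k. U k)" by blast
  qed
  have diam: "diameter (U k) = (if k < n then 1 / real n else 0)" for k
    using n0 by (simp add: U_def field_simps)
  have "1 / real n \<le> \<delta>" using n n0 \<delta> by (simp add: field_simps)
  then have "hausdorff_premeasure 1 \<delta> {0..<1::real} \<le> (\<Sum>k. hausdorff_cost 1 (U k))"
    unfolding hausdorff_premeasure_def
    using cover diam \<delta> by (intro INF_lower) (auto simp: U_def)
  also have "\<dots> = (\<Sum>k<n. hausdorff_cost 1 (U k))"
    by (rule suminf_finite) (auto simp: U_def hausdorff_cost_def)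
  also have "\<dots> = (\<Sum>k<n. ennreal (1 / real n))"
    by (intro sum.cong) (auto simp: hausdorff_cost_pos_exponent diam)
  also have "\<dots> = ennreal (\<Sum>k<n. 1 / real n)" by (rule sum_ennreal) auto
  also have "\<dots> = 1" using n0 by simp
  finally show "hausdorff_premeasure 1 \<delta> {0..<1::real} \<le> 1" .
qed

text \<open>Turns a bound on costs into one on lengths, the form of the hypothesis
  \<open>small\<close> in \<open>next_ball\<close>: \<open>d k\<close> is
  \<open>(d k powr s) powr (1 / s - 1)\<close> times \<open>d k powr s\<close>.\<close>

lemma sum_le_sum_powr:
  fixes d :: "'a \<Rightarrow> real"
  assumes s: "0 < s" "s < 1" and d: "\<And>k. k \<in> F \<Longrightarrow> 0 < d k" and w: "\<And>k. k \<in> F \<Longrightarrow> d k powr s \<le> w"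
  shows "(\<Sum>k\<in>F. d k) \<le> w powr (1 / s - 1) * (\<Sum>k\<in>F. d k powr s)"
  unfolding sum_distrib_left
proof (rule sum_mono)
  fix k assume k: "k \<in> F"
  have "d k = (d k powr s) powr (1 / s - 1) * d k powr s"
    using d[OF k] s by (simp add: powr_powr flip: powr_add) (simp add: field_simps)
  also have "\<dots> \<le> w powr (1 / s - 1) * d k powr s"
    using w[OF k] s d[OF k] by (intro mult_right_mono powr_mono2) auto
  finally show "d k \<le> w powr (1 / s - 1) * d k powr s" .
qed

text \<open>Mass transference inside a single ball. Were the measure finite, there would be a fine
  cover of finite cost; iterating \<open>next_ball\<close> against it leads to a point of
  \<open>A\<close> that no member of the cover can contain.\<close>

theorem (in full_limsup) hausdorff_measure_limsup_infinite:
  assumes s: "0 < s" "s < 1" and \<beta>: "0 < \<beta>"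
    and A: "\<And>x. x \<in> ball c \<beta> \<Longrightarrow> \<forall>T. \<exists>t\<ge>T. \<exists>p\<in>P t. \<bar>x - p\<bar> \<le> r t powr (1 / s) \<Longrightarrow> x \<in> A"
  shows "hausdorff_measure s A = \<infinity>"
proof (rule ccontr)
  assume "hausdorff_measure s A \<noteq> \<infinity>"
  then have "hausdorff_measure s A < \<infinity>" by (simp add: less_top)
  then obtain M where M: "0 \<le> M" "hausdorff_measure s A < ennreal M"
    by (metis ennreal_cases dense infinity_ennreal_def less_top not_less_iff_gr_or_eq)
  \<comment> \<open>A bound for each single cost, so small that \<open>sum_le_sum_powr\<close> turns
    total cost \<open>M + 1\<close> into total length at most \<open>\<beta> / 40\<close>.\<close>
  define w where "w = min 1 ((\<beta> / (40 * (M + 1))) powr (1 / (1 / s - 1)))"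
  have s1: "0 < 1 / s - 1" using s by (simp add: field_simps)
  have q: "0 < \<beta> / (40 * (M + 1))" using \<beta> M by simp
  have w: "0 < w" "w \<le> 1" using q by (auto simp: w_def)
  have w2: "w powr (1 / s - 1) \<le> \<beta> / (40 * (M + 1))"
  proof -
    have "w powr (1 / s - 1) \<le> ((\<beta> / (40 * (M + 1))) powr (1 / (1 / s - 1))) powr (1 / s - 1)"
      using w s1 by (intro powr_mono2) (auto simp: w_def)
    also have "\<dots> = (\<beta> / (40 * (M + 1))) powr 1"
      unfolding powr_powr using s s1 by simp
    also have "\<dots> = \<beta> / (40 * (M + 1))" by (rule powr_one[OF less_imp_le[OF q]])
    finally show ?thesis .
  qed
  have "hausdorff_premeasure s ((w / 2) powr (1 / s)) A \<le> hausdorff_measure s A"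
    unfolding hausdorff_measure_def
    using w SUP_upper[of "(w / 2) powr (1 / s)" "{0<..}" "\<lambda>\<delta>. hausdorff_premeasure s \<delta> A"] by simp
  then have "hausdorff_premeasure s ((w / 2) powr (1 / s)) A < ennreal M" using M(2) by (rule le_less_trans)
  then obtain U where U: "A \<subseteq> (\<Union>k. U k)"
      "\<And>k. bounded (U k)" "\<And>k. diameter (U k) \<le> (w / 2) powr (1 / s)"
      "(\<Sum>k. hausdorff_cost s (U k)) < ennreal M"
    unfolding hausdorff_premeasure_def INF_less_iff by blast
  \<comment> \<open>The geometric extra terms make every cost positive, as \<open>next_ball\<close>
    requires of \<open>d\<close>; they keep each cost at most \<open>w\<close> and add at most 1 in
    total.\<close>
  define D where "D k = diameter (U k) powr s + w / 2 * (1 / 2) ^ Suc k" for k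
  define d where "d k = D k powr (1 / s)" for k
  have D0: "0 < D k" for k using w by (auto simp: D_def intro!: add_nonneg_pos)
  have d0: "0 < d k" for k using D0[of k] by (simp add: d_def)
  have ds: "d k powr s = D k" for k using D0[of k] s by (simp add: d_def powr_powr)
  have Dw: "D k \<le> w" for k
  proof -
    have "diameter (U k) powr s \<le> ((w / 2) powr (1 / s)) powr s"
      using s U diameter_ge_0 by (intro powr_mono2) auto
    also have "\<dots> = w / 2" using s w by (simp add: powr_powr)
    finally have "diameter (U k) powr s \<le> w / 2" .
    moreover have "w / 2 * (1 / 2) ^ Suc k \<le> w / 2 * 1" using w by (intro mult_left_mono power_le_one) auto
    ultimately show ?thesis unfolding D_def by linarith
  qed
  have diam: "\<forall>k. \<forall>u\<in>U k. \<forall>v\<in>U k. \<bar>u - v\<bar> \<le> d k"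
  proof (intro allI ballI)
    fix k u v assume uv: "u \<in> U k" "v \<in> U k"
    have "\<bar>u - v\<bar> \<le> diameter (U k)"
      using diameter_bounded_bound[OF U(2) uv] by (simp add: dist_real_def)
    also have "\<dots> = (diameter (U k) powr s) powr (1 / s)"
      using s diameter_ge_0[OF U(2)] by (simp add: powr_powr)
    also have "\<dots> \<le> d k" unfolding d_def using s w by (intro powr_mono2) (auto simp: D_def)
    finally show "\<bar>u - v\<bar> \<le> d k" .
  qed
  have sumD: "(\<Sum>k\<in>F. d k powr s) \<le> M + 1" if "finite F" for F
  proof -
    have "ennreal (\<Sum>k\<in>F. diameter (U k) powr s) = (\<Sum>k\<in>F. hausdorff_cost s (U k))"
      by (simp add: hausdorff_cost_pos_exponent[OF s(1)] sum_ennreal)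
    also have "\<dots> \<le> (\<Sum>k. hausdorff_cost s (U k))" using that by (intro sum_le_suminf) auto
    also have "\<dots> \<le> ennreal M" using U(4) by simp
    finally have "(\<Sum>k\<in>F. diameter (U k) powr s) \<le> M" using M by (subst (asm) ennreal_le_iff) auto
    moreover have "(\<Sum>k\<in>F. w / 2 * (1 / 2) ^ Suc k) \<le> 1"
    proof -
      have "(\<Sum>k\<in>F. w / 2 * (1 / 2) ^ Suc k) \<le> (\<Sum>k\<in>F. (1 / 2) ^ Suc k)"
        using w by (intro sum_mono) auto
      also have "\<dots> \<le> (\<Sum>k. (1 / 2 :: real) ^ Suc k)"
        using that power_half_series by (intro sum_le_suminf) (auto dest: sums_summable)
      also have "\<dots> = 1" using power_half_series by (rule sums_unique[symmetric])
      finally show ?thesis .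
    qed
    ultimately show ?thesis by (simp only: ds D_def sum.distrib)
  qed
  let ?\<delta> = "\<lambda>t. r t powr (1 / s)"
  \<comment> \<open>With this choice \<open>(\<theta> * r t) powr (1 / s)\<close> is one fortieth of
    the shrunken radius, so the cost bound in \<open>cheap\<close> yields the hypothesis
    \<open>small\<close> for the next ball.\<close>
  define \<theta> where "\<theta> = (1 / 40 :: real) powr s"
  have \<theta>: "0 < \<theta>" by (simp add: \<theta>_def)
  define cheap where "cheap x \<longleftrightarrow> snd x \<in> P (fst x) \<and>
    (\<forall>F. finite F \<longrightarrow> (\<forall>k\<in>F. U k \<inter> cball (snd x) (?\<delta> (fst x)) \<noteq> {}) \<longrightarrow> (\<Sum>k\<in>F. d k powr s) \<le> \<theta> * r (fst x))"
    for x :: "nat \<times> real"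
  let ?C = "\<lambda>x. cball (snd x) (?\<delta> (fst x))"
  have step0: "\<exists>x. cheap x \<and> 0 \<le> fst x \<and> ?C x \<subseteq> ball c \<beta>"
  proof -
    have small: "\<forall>F. finite F \<longrightarrow> (\<forall>k\<in>F. U k \<inter> ball c \<beta> \<noteq> {}) \<longrightarrow> (\<Sum>k\<in>F. d k) \<le> \<beta> / 40"
    proof (intro allI impI)
      fix F :: "nat set" assume F: "finite F"
      have "(\<Sum>k\<in>F. d k) \<le> w powr (1 / s - 1) * (\<Sum>k\<in>F. d k powr s)"
        by (rule sum_le_sum_powr) (use s d0 ds Dw in auto)
      also have "\<dots> \<le> \<beta> / (40 * (M + 1)) * (M + 1)"
        using w2 sumD[OF F] q by (intro mult_mono sum_nonneg) auto
      also have "\<dots> = \<beta> / 40" using M by (simp add: divide_simps)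
      finally show "(\<Sum>k\<in>F. d k) \<le> \<beta> / 40" .
    qed
    have "\<forall>F. finite F \<longrightarrow> (\<forall>k\<in>F. U k \<inter> ball c \<beta> \<noteq> {}) \<longrightarrow> (\<Sum>k\<in>F. d k powr s) \<le> M + 1"
      using sumD by simp
    from next_ball[OF s \<beta> \<theta> d0 diam small this, of 0] obtain t p where "p \<in> P t" "cball p (?\<delta> t) \<subseteq> ball c \<beta>"
        "\<forall>F. finite F \<longrightarrow> (\<forall>k\<in>F. U k \<inter> cball p (?\<delta> t) \<noteq> {}) \<longrightarrow> (\<Sum>k\<in>F. d k powr s) \<le> \<theta> * r t"
      by (elim exE conjE) (rule that; assumption)
    then show ?thesis unfolding cheap_def by (intro exI[of _ "(t, p)"]) (simp only: fst_conv snd_conv le0 simp_thms)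
  qed
  have step: "\<exists>y. (cheap y \<and> Suc n \<le> fst y \<and> ?C y \<subseteq> ball c \<beta>) \<and> ?C y \<subseteq> ?C x"
    if x: "cheap x \<and> n \<le> fst x \<and> ?C x \<subseteq> ball c \<beta>" for x n
  proof -
    let ?b = "?\<delta> (fst x)"
    have b0: "0 < ?b" using r_pos[of "fst x"] by simp
    have bound: "\<forall>F. finite F \<longrightarrow> (\<forall>k\<in>F. U k \<inter> ball (snd x) ?b \<noteq> {}) \<longrightarrow> (\<Sum>k\<in>F. d k powr s) \<le> \<theta> * r (fst x)"
    proof (intro allI impI)
      fix F assume F: "finite F" "\<forall>k\<in>F. U k \<inter> ball (snd x) ?b \<noteq> {}"
      have "ball (snd x) ?b \<subseteq> ?C x" by auto
      then have "\<forall>k\<in>F. U k \<inter> ?C x \<noteq> {}" using F(2) by blast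
      then show "(\<Sum>k\<in>F. d k powr s) \<le> \<theta> * r (fst x)" using x F(1) by (simp add: cheap_def)
    qed
    have small: "\<forall>F. finite F \<longrightarrow> (\<forall>k\<in>F. U k \<inter> ball (snd x) ?b \<noteq> {}) \<longrightarrow> (\<Sum>k\<in>F. d k) \<le> ?b / 40"
    proof (intro allI impI)
      fix F assume F: "finite F" "\<forall>k\<in>F. U k \<inter> ball (snd x) ?b \<noteq> {}"
      have pos: "0 < \<theta> * r (fst x)" using \<theta> r_pos[of "fst x"] by simp
      have "d k powr s \<le> \<theta> * r (fst x)" if "k \<in> F" for k
        using bound[rule_format, of "{k}"] F(2) that by simp
      then have "(\<Sum>k\<in>F. d k) \<le> (\<theta> * r (fst x)) powr (1 / s - 1) * (\<Sum>k\<in>F. d k powr s)"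
        by (intro sum_le_sum_powr) (use s d0 in auto)
      also have "\<dots> \<le> (\<theta> * r (fst x)) powr (1 / s - 1) * (\<theta> * r (fst x))"
        using bound[rule_format, of F] F by (intro mult_left_mono) auto
      also have "\<dots> = (\<theta> * r (fst x)) powr (1 / s)"
        using pos by (simp add: powr_diff)
      also have "\<dots> = ?b / 40"
        using s r_pos[of "fst x"] by (simp add: powr_mult \<theta>_def powr_powr)
      finally show "(\<Sum>k\<in>F. d k) \<le> ?b / 40" .
    qed
    from next_ball[OF s b0 \<theta> d0 diam small bound, of "Suc n"] obtain t p where tp: "Suc n \<le> t" "p \<in> P t" "cball p (?\<delta> t) \<subseteq> ball (snd x) ?b"
        "\<forall>F. finite F \<longrightarrow> (\<forall>k\<in>F. U k \<inter> cball p (?\<delta> t) \<noteq> {}) \<longrightarrow> (\<Sum>k\<in>F. d k powr s) \<le> \<theta> * r t"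
      by (elim exE conjE) (rule that; assumption)
    have sub: "?C (t, p) \<subseteq> ?C x" using order_trans[OF tp(3) ball_subset_cball] by simp
    moreover have "?C (t, p) \<subseteq> ball c \<beta>" using sub x by (meson order_trans)
    moreover have "cheap (t, p)" unfolding cheap_def fst_conv snd_conv using tp(2,4) by (rule conjI)
    moreover have "Suc n \<le> fst (t, p)" using tp(1) by simp
    ultimately show ?thesis by (intro exI[of _ "(t, p)"] conjI)
  qed
  have "\<exists>f. \<forall>n. (cheap (f n) \<and> n \<le> fst (f n) \<and> ?C (f n) \<subseteq> ball c \<beta>) \<and> ?C (f (Suc n)) \<subseteq> ?C (f n)"
    by (rule dependent_nat_choice[OF step0 step])
  then obtain f where f': "\<forall>n. (cheap (f n) \<and> n \<le> fst (f n) \<and> ?C (f n) \<subseteq> ball c \<beta>) \<and> ?C (f (Suc n)) \<subseteq> ?C (f n)"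
    by (rule exE)
  have f: "\<And>n. cheap (f n) \<and> n \<le> fst (f n) \<and> ?C (f n) \<subseteq> ball c \<beta>" "\<And>n. ?C (f (Suc n)) \<subseteq> ?C (f n)"
    using f'[rule_format, THEN conjunct1] f'[rule_format, THEN conjunct2] .
  have "\<Inter>(range (\<lambda>n. ?C (f n))) \<noteq> {}"
  proof (rule compact_nest)
    show "?C (f n) \<subseteq> ?C (f m)" if "m \<le> n" for m n
      using that f(2) by (rule lift_Suc_antimono_le[rotated])
  qed auto
  then obtain x where x: "\<And>n. x \<in> ?C (f n)" by blast
  have "x \<in> A"
  proof (rule A)
    show "x \<in> ball c \<beta>" using x[of 0] f(1)[of 0] by (meson subsetD)
    show "\<forall>T. \<exists>t\<ge>T. \<exists>p\<in>P t. \<bar>x - p\<bar> \<le> r t powr (1 / s)"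
    proof
      fix T
      have "snd (f T) \<in> P (fst (f T))" "T \<le> fst (f T)" using f(1)[of T] by (auto simp: cheap_def)
      moreover have "\<bar>x - snd (f T)\<bar> \<le> ?\<delta> (fst (f T))" using x[of T] by (simp add: dist_real_def abs_minus_commute)
      ultimately show "\<exists>t\<ge>T. \<exists>p\<in>P t. \<bar>x - p\<bar> \<le> r t powr (1 / s)" by blast
    qed
  qed
  then obtain k where k: "x \<in> U k" using U(1) by blast
  \<comment> \<open>The member \<open>U k\<close> that contains \<open>x\<close> meets every ball of
    the nest, so \<open>d k powr s\<close> is at most \<open>\<theta> * r\<close> at levels tending
    to infinity, whereas \<open>d k\<close> is a fixed positive number.\<close>
  have le: "d k powr s \<le> \<theta> * r (fst (f n))" for n
  proof -
    have "U k \<inter> ?C (f n) \<noteq> {}" using x k by blast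
    moreover have "\<forall>F. finite F \<longrightarrow> (\<forall>k\<in>F. U k \<inter> ?C (f n) \<noteq> {}) \<longrightarrow> (\<Sum>k\<in>F. d k powr s) \<le> \<theta> * r (fst (f n))"
      using f(1)[of n] by (simp add: cheap_def)
    from this[rule_format, of "{k}"] show ?thesis using calculation by simp
  qed
  have "filterlim (\<lambda>n. fst (f n)) sequentially sequentially"
    by (rule filterlim_at_top_mono[OF filterlim_ident]) (use f(1) in auto)
  then have "(\<lambda>n. \<theta> * r (fst (f n))) \<longlonglongrightarrow> 0"
    using r_lim by (intro tendsto_mult_right_zero) (rule filterlim_compose)
  then have "d k powr s \<le> 0" using le by (intro LIMSEQ_le_const) auto
  then show False using d0[of k] by simp
qed

section \<open>Adic approximation\<close>

sublocale ubiquitous_system \<subseteq> full_limsup P r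
  using r_pos radius_tendsto_0 negligible_compl_neighbourhood
  by unfold_locales (auto simp: neighbourhood_def)

locale adic_approximation =
  fixes i j s :: real and D :: "nat \<Rightarrow> nat" and \<psi> :: "nat \<Rightarrow> real"
  assumes i: "0 < i" and j: "0 < j" and ij: "i + j = 1"
    and adic: "adic_sequence D" and ratios: "bounded_ratios D"
    and s: "i < s" "s \<le> 1"
    and \<psi>_nonneg: "\<And>q. 1 \<le> q \<Longrightarrow> 0 \<le> \<psi> q"
    and \<psi>_lim: "\<psi> \<longlonglongrightarrow> 0"
    and f_antimono: "antimono_on {1..} (f_psi i j s \<psi>)"
begin

abbreviation f where "f \<equiv> f_psi i j s \<psi>"

lemma s_pos: "0 < s" using i s by simp

lemma exponent_pos: "0 < i + j * s" using i j s_pos by (simp add: add_pos_pos)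

lemma f_nonneg: "0 \<le> f r" by (simp add: f_psi_def)

lemma f_le: "1 \<le> a \<Longrightarrow> a \<le> b \<Longrightarrow> f b \<le> f a"
  using f_antimono by (auto simp: monotone_on_def)

text \<open>As \<open>s \<le> 1\<close>, the factor \<open>r powr (1 - s)\<close> is nondecreasing,
  so any increase of \<open>\<psi>\<close> would make \<open>f\<close> increase as well.\<close>

lemma \<psi>_antimono:
  assumes "1 \<le> a" "a \<le> b"
  shows "\<psi> b \<le> \<psi> a"
proof (rule ccontr)
  assume "\<not> \<psi> b \<le> \<psi> a"
  then have lt: "\<psi> a powr (i + j * s) < \<psi> b powr (i + j * s)"
    using \<psi>_nonneg[OF assms(1)] exponent_pos by (intro powr_less_mono2) auto
  have "f a \<le> real b powr (1 - s) * \<psi> a powr (i + j * s)"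
    unfolding f_psi_def using assms s by (intro mult_right_mono powr_mono2) auto
  also have "\<dots> < real b powr (1 - s) * \<psi> b powr (i + j * s)"
    using assms lt by (intro mult_strict_left_mono) auto
  also have "\<dots> = f b" by (simp add: f_psi_def)
  finally show False using f_le[OF assms] by simp
qed

lemma D_pos: "0 < D k"
proof -
  have "strict_mono D" "D 0 = 1" using adic by (auto simp: adic_sequence_def)
  then have "D 0 \<le> D k" by (metis le0 strict_mono_less_eq)
  then show ?thesis using \<open>D 0 = 1\<close> by simp
qed

lemma le_D: "k \<le> D k"
  using adic by (auto simp: adic_sequence_def intro: strict_mono_imp_increasing)

lemma D_dvd: "m \<le> k \<Longrightarrow> D m dvd D k"
proof (induction k rule: dec_induct)
  case (step k)
  then show ?case using adic by (meson adic_sequence_def dvd_trans)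
qed simp

lemma adic_abs_le: "D m dvd q \<Longrightarrow> adic_abs D q \<le> 1 / real (D m)"
  unfolding adic_abs_def by (rule cInf_lower) (auto intro!: bdd_belowI[of _ 0])

text \<open>For \<open>q \<ge> 1\<close> only finitely many \<open>D m\<close> divide
  \<open>q\<close>, because \<open>m \<le> D m\<close>, and \<open>D 0 = 1\<close> always does; so
  the infimum is a minimum.\<close>

lemma adic_abs_attained:
  assumes "1 \<le> q"
  obtains m where "D m dvd q" "adic_abs D q = 1 / real (D m)"
proof -
  let ?X = "{1 / real (D m) | m. D m dvd q}"
  have "{m. D m dvd q} \<subseteq> {..q}"
    using assms le_D by (auto dest!: dvd_imp_le intro: order_trans)
  then have "finite {m. D m dvd q}" by (rule finite_subset) simp
  then have fin: "finite ?X" by (rule finite_image_set)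
  have "D 0 dvd q" using adic by (simp add: adic_sequence_def)
  then have ne: "?X \<noteq> {}" by blast
  have "Inf ?X \<in> ?X" using Min_in[OF fin ne] cInf_eq_Min[OF fin ne] by simp
  then show thesis using that by (auto simp: adic_abs_def)
qed

definition admissible :: "nat \<Rightarrow> bool" where
  "admissible q \<longleftrightarrow> 1 \<le> q \<and> (\<exists>m. D m dvd q \<and> 1 / real (D m) \<le> \<psi> q powr i)"

lemma approx_iff:
  assumes "1 \<le> q"
  shows "max (adic_abs D q powr (1 / i)) (dist_nearest_int (real q * x) powr (1 / j)) \<le> \<psi> q \<longleftrightarrow>
    admissible q \<and> dist_nearest_int (real q * x) \<le> \<psi> q powr j"
proof -
  have powr_iff: "y powr (1 / c) \<le> \<psi> q \<longleftrightarrow> y \<le> \<psi> q powr c" if "0 \<le> y" "0 < c" for y c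
  proof
    assume "y powr (1 / c) \<le> \<psi> q"
    then have "(y powr (1 / c)) powr c \<le> \<psi> q powr c" using that by (intro powr_mono2) auto
    then show "y \<le> \<psi> q powr c" using that by (simp add: powr_powr)
  next
    assume "y \<le> \<psi> q powr c"
    then have "y powr (1 / c) \<le> (\<psi> q powr c) powr (1 / c)" using that by (intro powr_mono2) auto
    then show "y powr (1 / c) \<le> \<psi> q" using that \<psi>_nonneg[OF assms] by (simp add: powr_powr)
  qed
  have "0 \<le> adic_abs D q" using adic_abs_attained[OF assms] by (metis of_nat_0_le_iff zero_le_divide_1_iff)
  moreover have "adic_abs D q \<le> \<psi> q powr i \<longleftrightarrow> admissible q"
    unfolding admissible_def using adic_abs_attained[OF assms] adic_abs_le assms by (metis order_trans)
  ultimately show ?thesis using powr_iff i j by (simp add: dist_nearest_int_def)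
qed

section \<open>Dyadic blocks and the convergent case\<close>

lemma condensation: "summable (\<lambda>r. f (Suc r)) \<longleftrightarrow> summable (\<lambda>t. 2 ^ t * f (2 ^ t))"
  unfolding summable_Suc_iff by (rule condensation_test) (auto intro: f_le f_nonneg)

lemma f_pow2: "f (2 ^ t) = (2 ^ t) powr (1 - s) * \<psi> (2 ^ t) powr (i + j * s)"
  by (simp add: f_psi_def)

text \<open>The terms of \<open>D\<close> form a divisibility chain, so all admissible
  \<open>q\<close> in the block are multiples of one term \<open>n\<close>, the first with
  \<open>1 / n \<le> \<psi> (2 ^ t) powr i\<close>. The block contains at most
  \<open>2 ^ Suc t / n\<close> of these multiples.\<close>

lemma block_card_le:
  "real (card {q \<in> {2 ^ t..<2 ^ Suc t}. admissible q}) \<le> 2 ^ Suc t * \<psi> (2 ^ t) powr i"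
proof (cases "{q \<in> {2 ^ t..<2 ^ Suc t}. admissible q} = {}")
  case True
  then show ?thesis by (simp only: card.empty) simp
next
  case False
  let ?Q = "{q \<in> {2 ^ t..<2 ^ Suc t}. admissible q}"
  let ?ok = "\<lambda>m. 1 / real (D m) \<le> \<psi> (2 ^ t) powr i"
  have ok: "\<exists>m. D m dvd q \<and> ?ok m" if q: "q \<in> ?Q" for q
  proof -
    obtain m where m: "D m dvd q" "1 / real (D m) \<le> \<psi> q powr i" using q by (auto simp: admissible_def)
    have "1 \<le> q" using q by (simp add: admissible_def)
    have "\<psi> q \<le> \<psi> (2 ^ t)" using q by (intro \<psi>_antimono) auto
    then have "\<psi> q powr i \<le> \<psi> (2 ^ t) powr i" using i \<psi>_nonneg[OF \<open>1 \<le> q\<close>] by (intro powr_mono2) auto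
    then show ?thesis using m by auto
  qed
  then have ex: "\<exists>m. ?ok m" using False by blast
  define n where "n = D (LEAST m. ?ok m)"
  have n: "1 / real n \<le> \<psi> (2 ^ t) powr i" unfolding n_def using ex by (rule LeastI_ex)
  have n0: "0 < n" by (simp add: n_def D_pos)
  have "?Q \<subseteq> (\<lambda>k. n * k) ` {1..2 ^ Suc t div n}"
  proof
    fix q assume q: "q \<in> ?Q"
    obtain m where m: "D m dvd q" "?ok m" using ok[OF q] by blast
    have "n dvd D m" unfolding n_def using m(2) by (intro D_dvd Least_le)
    then have "n dvd q" using m(1) by (rule dvd_trans)
    then obtain k where k: "q = n * k" by blast
    have "1 \<le> q" "q \<le> 2 ^ Suc t" using q by (auto simp: admissible_def)
    then have "k \<le> 2 ^ Suc t div n" "1 \<le> k"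
      using k n0 by (auto simp: less_eq_div_iff_mult_less_eq mult.commute Suc_le_eq intro!: Nat.gr0I)
    then show "q \<in> (\<lambda>k. n * k) ` {1..2 ^ Suc t div n}" using k by auto
  qed
  then have "card ?Q \<le> card {1..2 ^ Suc t div n}"
    by (meson card_image_le card_mono finite_atLeastAtMost finite_imageI order_trans)
  then have "real (card ?Q) \<le> real (2 ^ Suc t div n)" by simp
  also have "\<dots> \<le> real (2 ^ Suc t) / real n" by (rule of_nat_div_le_of_nat)
  also have "\<dots> = 2 ^ Suc t * (1 / real n)" by simp
  also have "\<dots> \<le> 2 ^ Suc t * \<psi> (2 ^ t) powr i" using n by (intro mult_left_mono) auto
  finally show ?thesis .
qed

text \<open>The summand is, up to a constant, the cost of the intervals with denominator
  \<open>q\<close>. Replacing \<open>q\<close> by \<open>2 ^ Suc t\<close> and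
  \<open>\<psi> q\<close> by \<open>\<psi> (2 ^ t)\<close> reduces the sum to
  \<open>block_card_le\<close>, and the powers combine to \<open>f (2 ^ t)\<close>.\<close>

lemma block_sum_le:
  "(\<Sum>q\<in>{2 ^ t..<2 ^ Suc t}. if admissible q then real q powr (1 - s) * \<psi> q powr (j * s) else 0)
    \<le> 4 * (2 ^ t * f (2 ^ t))"
proof -
  have js: "0 \<le> j * s" using j s_pos by simp
  define c where "c = (2 ^ Suc t :: real) powr (1 - s) * \<psi> (2 ^ t) powr (j * s)"
  have c0: "0 \<le> c" by (simp add: c_def)
  have "(\<Sum>q\<in>{2 ^ t..<2 ^ Suc t}. if admissible q then real q powr (1 - s) * \<psi> q powr (j * s) else 0)
      \<le> (\<Sum>q\<in>{2 ^ t..<2 ^ Suc t}. if admissible q then c else 0)"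
  proof (rule sum_mono)
    fix q :: nat assume q: "q \<in> {2 ^ t..<2 ^ Suc t}"
    have q1: "1 \<le> q" using q by (meson atLeastLessThan_iff le_trans one_le_numeral one_le_power)
    have "real q \<le> 2 ^ Suc t" using q by (metis atLeastLessThan_iff less_imp_le of_nat_le_iff of_nat_numeral of_nat_power)
    then have "real q powr (1 - s) \<le> (2 ^ Suc t) powr (1 - s)" using s by (intro powr_mono2) auto
    moreover have "\<psi> q powr (j * s) \<le> \<psi> (2 ^ t) powr (j * s)"
      using js q \<psi>_nonneg[OF q1] by (intro powr_mono2 \<psi>_antimono) auto
    ultimately show "(if admissible q then real q powr (1 - s) * \<psi> q powr (j * s) else 0) \<le> (if admissible q then c else 0)"
      unfolding c_def by (auto intro!: mult_mono)
  qed
  also have "\<dots> = real (card {q \<in> {2 ^ t..<2 ^ Suc t}. admissible q}) * c"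
    by (simp add: sum.If_cases Int_def)
  also have "\<dots> \<le> 2 ^ Suc t * \<psi> (2 ^ t) powr i * c"
    using block_card_le c0 by (rule mult_right_mono)
  also have "\<dots> = 2 * 2 powr (1 - s) * (2 ^ t * f (2 ^ t))"
    unfolding c_def f_pow2 by (simp add: powr_mult powr_add mult_ac)
  also have "\<dots> \<le> 4 * (2 ^ t * f (2 ^ t))"
  proof (rule mult_right_mono)
    have "2 powr (1 - s) \<le> (2::real) powr 1" using s_pos by (intro powr_mono) auto
    then show "2 * 2 powr (1 - s) \<le> (4::real)" by simp
  qed (simp add: f_nonneg)
  finally show ?thesis .
qed

theorem convergence:
  assumes sm: "summable (\<lambda>r. f (Suc r))"
  shows "hausdorff_measure s (W_adic D i j \<psi>) = 0"
proof -
  define u where "u q = (if admissible q then real q powr (1 - s) * \<psi> q powr (j * s) else 0)" for q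
  define B where "B t = 4 * (2 ^ t * f (2 ^ t))" for t
  have u0: "0 \<le> u q" for q by (simp add: u_def)
  have B0: "0 \<le> B t" for t by (simp add: B_def f_nonneg)
  have Bsum: "summable B" unfolding B_def using sm condensation by (intro summable_mult) auto
  have part: "(\<Sum>q<2 ^ n. u q) \<le> (\<Sum>t<n. B t)" for n
  proof (induction n)
    case 0
    show ?case by (simp add: u_def admissible_def)
  next
    case (Suc n)
    have "{..<2 ^ Suc n} = {..<2 ^ n} \<union> {2 ^ n..<2 ^ Suc n :: nat}" by auto
    then have "(\<Sum>q<2 ^ Suc n. u q) = sum u ({..<2 ^ n} \<union> {2 ^ n..<2 ^ Suc n})" by (rule arg_cong)
    also have "\<dots> = (\<Sum>q<2 ^ n. u q) + (\<Sum>q\<in>{2 ^ n..<2 ^ Suc n}. u q)"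
      by (rule sum.union_disjoint) auto
    also have "\<dots> \<le> (\<Sum>t<n. B t) + B n"
      using Suc block_sum_le[of n] unfolding u_def B_def by (intro add_mono) auto
    finally show ?case by simp
  qed
  have usum: "summable u"
  proof (rule summableI_nonneg_bounded[OF u0])
    fix n
    have "(\<Sum>q<n. u q) \<le> (\<Sum>q<2 ^ n. u q)"
      using u0 less_exp[of n] by (intro sum_mono2) auto
    also have "\<dots> \<le> (\<Sum>t<n. B t)" by (rule part)
    also have "\<dots> \<le> (\<Sum>t. B t)" using Bsum B0 by (intro sum_le_suminf) auto
    finally show "(\<Sum>q<n. u q) \<le> (\<Sum>t. B t)" .
  qed
  \<comment> \<open>For \<open>x\<close> in the unit interval the nearest integer to
    \<open>q * x\<close> is some \<open>a\<close> between 0 and \<open>q\<close>, so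
    \<open>q + 1\<close> intervals per admissible denominator suffice.\<close>
  define V where "V q a = (if admissible q then cball (real a / real q) (\<psi> q powr j / real q) else {})" for q a :: nat
  show ?thesis
  proof (rule hausdorff_measure_limsup_eq_0[OF s_pos, where V = V and n = "\<lambda>q. q"])
    show "bounded (V q a)" for q a by (simp add: V_def)
    show "summable (\<lambda>q. \<Sum>a\<le>q. diameter (V q a) powr s)"
    proof (rule summable_comparison_test)
      show "summable (\<lambda>q. 4 * u q)" using usum by (rule summable_mult)
      have "(\<Sum>a\<le>q. diameter (V q a) powr s) \<le> 4 * u q" for q
      proof (cases "admissible q")
        case True
        then have q: "1 \<le> q" by (simp add: admissible_def)
        have "diameter (V q a) = 2 * (\<psi> q powr j / real q)" for a
        proof -
          have "\<not> \<psi> q powr j / real q < 0" by (simp add: not_less del: divide_less_0_iff)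
          with True show ?thesis by (simp only: V_def if_True diameter_cball if_False)
        qed
        then have "(\<Sum>a\<le>q. diameter (V q a) powr s) = (1 + real q) * (2 * (\<psi> q powr j / real q)) powr s"
          by simp
        also have "\<dots> = (1 + real q) * (2 powr s * (\<psi> q powr (j * s) / real q powr s))"
          by (simp add: powr_mult powr_divide powr_powr)
        also have "\<dots> \<le> (2 * real q) * (2 * (\<psi> q powr (j * s) / real q powr s))"
        proof (intro mult_mono)
          have "2 powr s \<le> (2::real) powr 1" using s by (intro powr_mono) auto
          then show "2 powr s \<le> (2::real)" by simp
        qed (use q in auto)
        also have "\<dots> = 4 * u q" using True q by (simp add: u_def powr_diff)
        finally show ?thesis .
      next
        case False
        then show ?thesis by (simp add: V_def u_def)
      qed
      then show "\<exists>N. \<forall>q\<ge>N. norm (\<Sum>a\<le>q. diameter (V q a) powr s) \<le> 4 * u q"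
        by (auto simp: sum_nonneg)
    qed
    fix x assume x: "x \<in> W_adic D i j \<psi>"
    let ?Q = "{q::nat. q \<ge> 1 \<and> max (adic_abs D q powr (1 / i)) (dist_nearest_int (real q * x) powr (1 / j)) \<le> \<psi> q}"
    have x01: "0 \<le> x" "x < 1" and inf: "infinite ?Q" using x by (auto simp: W_adic_def)
    have "?Q \<subseteq> {q. \<exists>a\<le>q. x \<in> V q a}"
    proof
      fix q assume "q \<in> ?Q"
      then have q: "1 \<le> q" "admissible q" "dist_nearest_int (real q * x) \<le> \<psi> q powr j"
        using approx_iff by auto
      define a where "a = nat (round (real q * x))"
      have "real q * x \<le> real q" using x01 by (simp add: mult_left_le)
      then have "round (real q * x) \<le> round (real q)" by (rule round_mono)
      then have a1: "a \<le> q" by (simp add: a_def)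
      have "round (0::real) \<le> round (real q * x)" using x01 by (intro round_mono) auto
      then have a2: "real_of_int (round (real q * x)) = real a" by (simp add: a_def)
      have "\<bar>real q * x - real a\<bar> \<le> \<psi> q powr j" using q(3) by (simp add: dist_nearest_int_def a2)
      moreover have "\<bar>real q * x - real a\<bar> = real q * \<bar>x - real a / real q\<bar>"
      proof -
        have "real q * x - real a = real q * (x - real a / real q)" using q(1) by (simp add: field_simps)
        then show ?thesis by (simp add: abs_mult)
      qed
      ultimately have "\<bar>x - real a / real q\<bar> \<le> \<psi> q powr j / real q" using q(1) by (simp add: field_simps)
      then have "x \<in> V q a" using q(2) by (simp add: V_def dist_real_def abs_minus_commute)
      then show "q \<in> {q. \<exists>a\<le>q. x \<in> V q a}" using a1 by blast
    qed
    then show "infinite {q. \<exists>a\<le>q. x \<in> V q a}" using inf by (rule infinite_super)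
  qed
qed


text \<open>In the divergent case \<open>\<psi> (2 ^ t)\<close> is positive, so the set behind
  \<open>LEAST\<close> is nonempty and \<open>base t\<close> is the term \<open>n\<^sub>t\<close> of
  the introduction.\<close>

definition base_level :: "nat \<Rightarrow> nat" where
  "base_level t = (LEAST m. 1 / real (D m) \<le> \<psi> (2 ^ t) powr i)"

definition base :: "nat \<Rightarrow> nat" where
  "base t = D (base_level t)"

definition points :: "nat \<Rightarrow> real set" where
  "points t = farey_points (base t) (2 ^ t div base t)"

text \<open>The density scale \<open>N\<^sub>t\<close>, not a cardinality: on a fixed interval and
  for large \<open>t\<close>, the number of points per unit length agrees with it up to constant
  factors.\<close>

definition point_count :: "nat \<Rightarrow> real" where
  "point_count t = real (base t * (2 ^ t div base t)\<^sup>2)"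

text \<open>Small enough for all denominators \<open>1 \<le> q \<le> 2 ^ t\<close> at once, because
  \<open>\<psi> (2 ^ t) powr j / 2 ^ t \<le> \<psi> q powr j / q\<close> by monotonicity.\<close>

definition target_radius :: "nat \<Rightarrow> real" where
  "target_radius t = \<psi> (2 ^ t) powr j / 2 ^ t"

lemma base_pos: "0 < base t"
  by (simp add: base_def D_pos)

section \<open>The divergent case: ubiquity of the adic rationals\<close>

context
  assumes diverge: "\<not> summable (\<lambda>r. f (Suc r))"
begin

text \<open>A zero of \<open>\<psi>\<close> would persist by monotonicity and leave only finitely
  many nonzero terms in the series.\<close>

lemma \<psi>_pos: "1 \<le> q \<Longrightarrow> 0 < \<psi> q"
proof (rule ccontr)
  assume q: "1 \<le> q" "\<not> 0 < \<psi> q"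
  have "summable (\<lambda>r. f (Suc r))"
  proof (rule summable_finite)
    show "finite {..<q}" by simp
    fix r assume "r \<notin> {..<q}"
    then have "q \<le> Suc r" by simp
    then have "\<psi> (Suc r) \<le> \<psi> q" using q(1) by (intro \<psi>_antimono)
    then have "\<psi> (Suc r) = 0" using q(2) \<psi>_nonneg[of "Suc r"] by simp
    then show "f (Suc r) = 0" by (simp add: f_psi_def)
  qed
  then show False using diverge by simp
qed

lemma \<psi>_pow2_pos: "0 < \<psi> (2 ^ t)"
  by (rule \<psi>_pos) simp

lemma base_inverse_le: "1 / real (base t) \<le> \<psi> (2 ^ t) powr i"
proof -
  define y where "y = \<psi> (2 ^ t) powr i"
  have y: "0 < y" using \<psi>_pow2_pos[of t] by (simp add: y_def)
  obtain m :: nat where m: "1 / y < real m" using reals_Archimedean2 by blast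
  also have "real m \<le> real (D m)" using le_D by simp
  finally have "1 / real (D m) \<le> y" using y D_pos[of m] by (simp add: field_simps)
  then show ?thesis unfolding base_def base_level_def y_def by (rule LeastI)
qed

lemma \<psi>_pow2_powr_tendsto_0:
  assumes "0 < c"
  shows "(\<lambda>t. \<psi> (2 ^ t) powr c) \<longlonglongrightarrow> 0"
proof -
  have "filterlim (\<lambda>t. 2 ^ t :: nat) sequentially sequentially"
    by (rule filterlim_at_top_mono[OF filterlim_ident]) (auto intro: less_imp_le less_exp)
  then have "(\<lambda>t. \<psi> (2 ^ t)) \<longlonglongrightarrow> 0" using \<psi>_lim by (rule filterlim_compose[rotated])
  then have "(\<lambda>t. \<psi> (2 ^ t) powr c) \<longlonglongrightarrow> 0 powr c"
    using assms \<psi>_pow2_pos by (intro tendsto_powr2 tendsto_const) (auto simp: less_imp_le)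
  then show ?thesis by simp
qed

lemma base_large: "\<forall>\<^sub>F t in sequentially. K \<le> real (base t)"
proof -
  have "\<forall>\<^sub>F t in sequentially. \<psi> (2 ^ t) powr i < 1 / (\<bar>K\<bar> + 1)"
    using \<psi>_pow2_powr_tendsto_0[OF i] by (rule order_tendstoD) simp
  then show ?thesis
  proof eventually_elim
    case (elim t)
    then have "1 / real (base t) < 1 / (\<bar>K\<bar> + 1)" using base_inverse_le[of t] by linarith
    then have "\<bar>K\<bar> + 1 < real (base t)" using base_pos[of t] by (simp add: field_simps)
    then show ?case by linarith
  qed
qed

lemma target_radius_pos: "0 < target_radius t"
  using \<psi>_pow2_pos[of t] by (simp add: target_radius_def)

lemma target_radius_decay: "target_radius (t + k) \<le> (1 / 2) ^ k * target_radius t"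
proof -
  have "\<psi> (2 ^ (t + k)) powr j \<le> \<psi> (2 ^ t) powr j"
    using j \<psi>_pow2_pos[of "t + k"] by (intro powr_mono2 \<psi>_antimono) auto
  then have "target_radius (t + k) \<le> \<psi> (2 ^ t) powr j / 2 ^ (t + k)"
    unfolding target_radius_def by (intro divide_right_mono) auto
  also have "\<dots> = (1 / 2) ^ k * target_radius t"
    by (simp add: target_radius_def power_add power_divide mult.commute)
  finally show ?thesis .
qed

text \<open>Here bounded ratios enter. The term preceding \<open>base t\<close> still fails the
  defining inequality, so \<open>\<psi> (2 ^ t) powr i * base t\<close> is at most one ratio of
  consecutive terms. At level 0 the base is 1, and the product is eventually below 1.\<close>

lemma base_upper:
  obtains C where "1 \<le> C" "\<forall>\<^sub>F t in sequentially. \<psi> (2 ^ t) powr i * real (base t) \<le> C"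
proof -
  obtain C0 where C0: "\<And>k. real (D (Suc k)) / real (D k) \<le> C0" using ratios by (auto simp: bounded_ratios_def)
  have "\<forall>\<^sub>F t in sequentially. \<psi> (2 ^ t) powr i < 1"
    using \<psi>_pow2_powr_tendsto_0[OF i] by (rule order_tendstoD) simp
  then have "\<forall>\<^sub>F t in sequentially. \<psi> (2 ^ t) powr i * real (base t) \<le> max 1 C0"
  proof eventually_elim
    case (elim t)
    show ?case
    proof (cases "base_level t")
      case 0
      then have "base t = 1" using adic by (simp add: base_def adic_sequence_def)
      then show ?thesis using elim by simp
    next
      case (Suc m)
      then have "\<not> 1 / real (D m) \<le> \<psi> (2 ^ t) powr i"
        using not_less_Least[of m "\<lambda>m. 1 / real (D m) \<le> \<psi> (2 ^ t) powr i"] by (simp add: base_level_def)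
      then have "\<psi> (2 ^ t) powr i * real (base t) \<le> 1 / real (D m) * real (base t)"
        by (intro mult_right_mono) auto
      also have "\<dots> \<le> C0" using C0[of m] Suc by (simp add: base_def)
      finally show ?thesis by simp
    qed
  qed
  then show thesis using that[of "max 1 C0"] by simp
qed

text \<open>Levels with \<open>base t > 2 ^ t\<close> carry no points; their contribution to the condensed series is
  geometric because of the hypothesis \<open>i < s\<close>.\<close>

lemma level_bound:
  assumes C: "1 \<le> C" and base: "\<psi> (2 ^ t) powr i * real (base t) \<le> C"
  shows "2 ^ t * f (2 ^ t) \<le> 4 * C * (target_radius t powr s * point_count t)
    + C powr ((i + j * s) / i) * (2 powr (1 - s / i)) ^ t"
proof -
  define x where "x = (2::real) ^ t"
  define y where "y = \<psi> (2 ^ t)"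
  have x: "0 < x" and y: "0 < y" using \<psi>_pow2_pos[of t] by (auto simp: x_def y_def)
  have fx: "f (2 ^ t) = x powr (1 - s) * y powr (i + j * s)" by (simp add: f_pow2 x_def y_def)
  have rad: "target_radius t powr s = y powr (j * s) / x powr s"
    using y by (simp add: target_radius_def x_def y_def powr_divide powr_powr)
  have nonneg: "0 \<le> 4 * C * (target_radius t powr s * point_count t)"
    using C by (simp add: point_count_def)
  have nonneg': "0 \<le> C powr ((i + j * s) / i) * (2 powr (1 - s / i)) ^ t" by simp
  show ?thesis
  proof (cases "base t \<le> 2 ^ t")
    case True
    let ?n = "base t" and ?R = "2 ^ t div base t"
    have "2 ^ t = ?n * ?R + 2 ^ t mod ?n" by simp
    moreover have "2 ^ t mod ?n < ?n" using base_pos by simp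
    moreover have "?n * 1 \<le> ?n * ?R"
      using True base_pos[of t] by (intro mult_le_mono2) (simp add: Suc_le_eq div_greater_zero_iff)
    \<comment> \<open>Rounding \<open>2 ^ t / base t\<close> down loses at most a factor 2, hence
      the factor 4 after squaring.\<close>
    ultimately have "2 ^ t \<le> 2 * (?n * ?R)" by linarith
    then have "real (2 ^ t) \<le> real (2 * (?n * ?R))" by (rule of_nat_mono)
    then have "x \<le> 2 * (real ?n * real ?R)" by (simp add: x_def del: of_nat_div)
    then have "x\<^sup>2 \<le> (2 * (real ?n * real ?R))\<^sup>2" using x by (intro power_mono) auto
    also have "\<dots> = 4 * real ?n * point_count t"
      by (simp add: point_count_def power2_eq_square del: of_nat_div)
    finally have x2: "x\<^sup>2 \<le> 4 * real ?n * point_count t" .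
    have "2 ^ t * f (2 ^ t) = x\<^sup>2 * y powr i * (y powr (j * s) / x powr s)"
      using x by (simp add: fx x_def[symmetric] powr_diff powr_add power2_eq_square)
    also have "\<dots> = x\<^sup>2 * (y powr i * target_radius t powr s)" by (simp add: rad)
    also have "\<dots> \<le> 4 * real ?n * point_count t * (y powr i * target_radius t powr s)"
      using x2 by (intro mult_right_mono) auto
    also have "\<dots> = 4 * (y powr i * real ?n) * (target_radius t powr s * point_count t)" by (simp add: mult_ac)
    also have "\<dots> \<le> 4 * C * (target_radius t powr s * point_count t)"
      using base by (intro mult_right_mono mult_left_mono) (auto simp: y_def point_count_def)
    finally show ?thesis using nonneg' by linarith
  next
    case False
    then have "2 ^ t \<le> base t" by simp
    then have "real (2 ^ t) \<le> real (base t)" by (rule of_nat_mono)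
    then have "y powr i * x \<le> y powr i * real (base t)" by (intro mult_left_mono) (auto simp: x_def)
    then have "y powr i * x \<le> C" using base by (simp add: y_def)
    \<comment> \<open>A base of at least \<open>2 ^ t\<close> forces
      \<open>\<psi> (2 ^ t) powr i\<close> down to \<open>C / 2 ^ t\<close>; the power
      \<open>(i + j * s) / i\<close> of this bounds the corresponding factor of
      \<open>f\<close>.\<close>
    then have yC: "y powr i \<le> C / x" using x by (simp add: field_simps)
    have "y powr (i + j * s) = (y powr i) powr ((i + j * s) / i)" using i by (simp add: powr_powr)
    also have "\<dots> \<le> (C / x) powr ((i + j * s) / i)"
      using yC i exponent_pos by (intro powr_mono2) auto
    also have "\<dots> = C powr ((i + j * s) / i) * x powr (- ((i + j * s) / i))"
      unfolding powr_divide powr_minus by (rule divide_inverse)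
    finally have "2 ^ t * f (2 ^ t) \<le> x powr 1 * (x powr (1 - s) * (C powr ((i + j * s) / i) * x powr (- ((i + j * s) / i))))"
      unfolding fx using x by (intro mult_mono) (auto simp: x_def)
    also have "\<dots> = C powr ((i + j * s) / i) * (x powr 1 * x powr (1 - s) * x powr (- ((i + j * s) / i)))"
      by (simp only: mult_ac)
    also have "x powr 1 * x powr (1 - s) * x powr (- ((i + j * s) / i)) = x powr (1 - s / i)"
    proof -
      \<comment> \<open>Through \<open>i + j = 1\<close> the exponent becomes
        \<open>1 - s / i\<close>, which is negative since \<open>i < s\<close>.\<close>
      have "1 + (1 - s) + - ((i + j * s) / i) = 1 - (i + j) * s / i" using i by (simp add: field_simps)
      also have "\<dots> = 1 - s / i" by (simp add: ij)
      finally show ?thesis unfolding powr_add[symmetric] by (rule arg_cong)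
    qed
    also have "x powr (1 - s / i) = (2 powr (1 - s / i)) ^ t"
      by (simp add: x_def powr_powr powr_realpow[symmetric] mult.commute)
    finally show ?thesis using nonneg by linarith
  qed
qed

text \<open>The radii are the target radii to the power \<open>s\<close>, as mass transference
  requires. The constant \<open>1 / 128\<close> comes from \<open>card_farey_points_lower\<close>;
  the ratio reflects that \<open>target_radius\<close> at least halves from one level to the
  next.\<close>

lemma ubiquitous:
  "ubiquitous_system points point_count (\<lambda>t. target_radius t powr s) (1 / 128) ((1 / 2) powr s)"
proof
  show "(0::real) < 1 / 128" "(0::real) < (1 / 2) powr s" by simp_all
  show "(1 / 2 :: real) powr s < 1" using s_pos powr_less_mono2[of s "1 / 2" 1] by simp
  show "0 < target_radius t powr s" for t using target_radius_pos[of t] by simp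
  show "0 \<le> point_count t" for t by (simp add: point_count_def)
  show "1 \<le> point_count t * \<bar>p - q\<bar>" if "p \<in> points t" "q \<in> points t" "p \<noteq> q" for t p q
    using farey_points_separated[OF base_pos that[unfolded points_def]] by (simp only: point_count_def)
  show "\<forall>\<^sub>F t in sequentially. 1 / 128 * (b - a) * point_count t \<le> real (card (points t \<inter> {a..b}))"
    if "a < b" for a b :: real
    using base_large[of "4 / (b - a)"]
  proof eventually_elim
    case (elim t)
    then have "4 \<le> (b - a) * real (base t)" using that by (simp add: field_simps)
    from card_farey_points_lower[OF base_pos that this, of "2 ^ t div base t"]
    show ?case by (simp add: points_def point_count_def del: of_nat_div)
  qed
  show "\<forall>\<^sub>F t in sequentially. real (card (points t \<inter> {a..b})) \<le> 2 * (b - a) * point_count t"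
    if "a < b" for a b :: real
    using base_large[of "1 / (b - a)"]
  proof eventually_elim
    case (elim t)
    then have "1 \<le> (b - a) * real (base t)" using that by (simp add: field_simps)
    from card_farey_points_upper[OF base_pos that this, of "2 ^ t div base t"]
    show ?case by (simp only: points_def point_count_def)
  qed
  show "target_radius (t + k) powr s \<le> ((1 / 2) powr s) ^ k * target_radius t powr s" for t k
  proof -
    have "target_radius (t + k) powr s \<le> ((1 / 2) ^ k * target_radius t) powr s"
      using target_radius_decay target_radius_pos[of "t + k"] s_pos by (intro powr_mono2) auto
    also have "\<dots> = ((1 / 2) ^ k) powr s * target_radius t powr s"
      by (rule powr_mult)
    also have "((1 / 2 :: real) ^ k) powr s = ((1 / 2) powr s) ^ k"
      by (simp add: powr_powr powr_realpow[symmetric] mult.commute)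
    finally show ?thesis .
  qed
  show "\<not> summable (\<lambda>t. target_radius t powr s * point_count t)"
  proof
    assume sm: "summable (\<lambda>t. target_radius t powr s * point_count t)"
    obtain C where C: "1 \<le> C" "\<forall>\<^sub>F t in sequentially. \<psi> (2 ^ t) powr i * real (base t) \<le> C"
      by (rule base_upper)
    have "(2::real) powr (1 - s / i) < 1"
      using i s powr_less_mono[of "1 - s / i" 0 "2::real"] by (simp add: field_simps)
    then have "summable (\<lambda>t. ((2::real) powr (1 - s / i)) ^ t)" by (intro summable_geometric) simp
    then have sm': "summable (\<lambda>t. 4 * C * (target_radius t powr s * point_count t)
        + C powr ((i + j * s) / i) * (2 powr (1 - s / i)) ^ t)"
      using sm by (intro summable_add summable_mult)
    have "summable (\<lambda>t. 2 ^ t * f (2 ^ t))"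
    proof (rule summable_comparison_test_ev[OF _ sm'])
      show "\<forall>\<^sub>F t in sequentially. norm (2 ^ t * f (2 ^ t)) \<le> 4 * C * (target_radius t powr s * point_count t)
          + C powr ((i + j * s) / i) * (2 powr (1 - s / i)) ^ t"
        using C(2)
      proof eventually_elim
        case (elim t)
        then show ?case using level_bound[OF C(1)] f_nonneg[of "2 ^ t"] by simp
      qed
    qed
    then show False using diverge condensation by simp
  qed
qed

text \<open>A point of level \<open>t\<close> has a denominator
  \<open>q = base t * r \<le> 2 ^ t\<close>, which is admissible as a multiple of
  \<open>base t\<close>. Several levels may share a denominator, but \<open>q \<ge> base t\<close>
  and \<open>base t\<close> tends to infinity, so infinitely many \<open>q\<close> occur.\<close>

lemma limsup_subset_W:
  assumes x: "x \<in> {0..<1}" and lim: "\<forall>T. \<exists>t\<ge>T. \<exists>p\<in>points t. \<bar>x - p\<bar> \<le> target_radius t"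
  shows "x \<in> W_adic D i j \<psi>"
proof -
  have "\<exists>q\<ge>K. q \<ge> 1 \<and> max (adic_abs D q powr (1 / i)) (dist_nearest_int (real q * x) powr (1 / j)) \<le> \<psi> q" for K :: nat
  proof -
    obtain T where T: "\<And>t. T \<le> t \<Longrightarrow> real K \<le> real (base t)"
      using base_large[of "real K"] by (auto simp: eventually_sequentially)
    obtain t p where t: "T \<le> t" "p \<in> points t" "\<bar>x - p\<bar> \<le> target_radius t" using lim by blast
    obtain h r where p: "p = of_int h / (real (base t) * real r)" "1 \<le> r" "r \<le> 2 ^ t div base t"
      using t(2) unfolding points_def farey_points_def by blast
    define q where "q = base t * r"
    have bq: "base t \<le> q" using p(2) by (simp add: q_def)
    have q1: "1 \<le> q" using bq base_pos[of t] by linarith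
    have "q \<le> base t * (2 ^ t div base t)" unfolding q_def using p(3) by (rule mult_le_mono2)
    also have "\<dots> \<le> 2 ^ t" by simp
    finally have q2: "q \<le> 2 ^ t" .
    have \<psi>q: "\<psi> (2 ^ t) powr c \<le> \<psi> q powr c" if "0 < c" for c
      using that q1 q2 \<psi>_pow2_pos[of t] by (intro powr_mono2 \<psi>_antimono) auto
    have "1 / real (base t) \<le> \<psi> q powr i" using base_inverse_le[of t] \<psi>q[OF i] by linarith
    moreover have "D (base_level t) dvd q" by (simp add: q_def base_def)
    ultimately have adm: "admissible q" using q1 unfolding admissible_def base_def by blast
    have "dist_nearest_int (real q * x) \<le> \<bar>real q * x - of_int h\<bar>"
      unfolding dist_nearest_int_def by (rule round_diff_minimal)
    also have "real q * x - of_int h = real q * (x - p)"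
      using base_pos[of t] p(2) by (simp add: q_def p(1) field_simps)
    also have "\<bar>real q * (x - p)\<bar> = real q * \<bar>x - p\<bar>" by (simp add: abs_mult)
    also have "\<dots> \<le> 2 ^ t * target_radius t"
    proof (intro mult_mono t(3))
      show "real q \<le> 2 ^ t" using q2 by (metis of_nat_le_iff of_nat_numeral of_nat_power)
    qed auto
    also have "\<dots> = \<psi> (2 ^ t) powr j" by (simp add: target_radius_def)
    also have "\<dots> \<le> \<psi> q powr j" using j by (rule \<psi>q)
    finally have "dist_nearest_int (real q * x) \<le> \<psi> q powr j" .
    then have "max (adic_abs D q powr (1 / i)) (dist_nearest_int (real q * x) powr (1 / j)) \<le> \<psi> q"
      using adm approx_iff[OF q1] by blast
    moreover have "K \<le> q" using T[OF t(1)] bq by linarith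
    ultimately show ?thesis using q1 by blast
  qed
  then have "infinite {q::nat. q \<ge> 1 \<and> max (adic_abs D q powr (1 / i)) (dist_nearest_int (real q * x) powr (1 / j)) \<le> \<psi> q}"
    unfolding infinite_nat_iff_unbounded_le by simp
  then show ?thesis using x by (simp add: W_adic_def)
qed

text \<open>For \<open>s < 1\<close> both sides are infinite, by mass transference on the open unit
  interval. For \<open>s = 1\<close> both are 1, by comparison with Lebesgue measure outside a null
  set.\<close>

theorem divergence: "hausdorff_measure s (W_adic D i j \<psi>) = hausdorff_measure s {0..<1::real}"
proof -
  interpret ubiquitous_system points point_count "\<lambda>t. target_radius t powr s" "1 / 128" "(1 / 2) powr s"
    by (rule ubiquitous)
  have le: "hausdorff_measure s (W_adic D i j \<psi>) \<le> hausdorff_measure s {0..<1::real}"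
    by (rule hausdorff_measure_mono) (auto simp: W_adic_def)
  show ?thesis
  proof (cases "s = 1")
    case False
    then have s1: "s < 1" using s by simp
    have "hausdorff_measure s (W_adic D i j \<psi>) = \<infinity>"
    proof (rule hausdorff_measure_limsup_infinite[OF s_pos s1, of "1 / 2" "1 / 2"])
      fix x :: real
      assume x: "x \<in> ball (1 / 2) (1 / 2)"
        and lim: "\<forall>T. \<exists>t\<ge>T. \<exists>p\<in>points t. \<bar>x - p\<bar> \<le> (target_radius t powr s) powr (1 / s)"
      have "(target_radius t powr s) powr (1 / s) = target_radius t" for t
        using s_pos target_radius_pos[of t] by (simp add: powr_powr)
      moreover have "x \<in> {0..<1}" using x by (auto simp: dist_real_def abs_if split: if_splits)
      ultimately show "x \<in> W_adic D i j \<psi>" using lim by (intro limsup_subset_W) auto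
    qed simp
    then show ?thesis using le by (simp add: top_unique)
  next
    case True
    define Z where "Z = (\<Union>T. - neighbourhood T)"
    have "negligible Z" unfolding Z_def
      by (intro negligible_countable_Union) (use negligible_compl_neighbourhood in auto)
    then have Z: "Z \<in> null_sets lebesgue" by (simp add: negligible_iff_null_sets)
    have "{0..<1} - Z \<subseteq> W_adic D i j \<psi>"
    proof
      fix x assume x: "x \<in> {0..<1} - Z"
      have "\<exists>t\<ge>T. \<exists>p\<in>points t. \<bar>x - p\<bar> \<le> target_radius t" for T
      proof -
        have "x \<in> neighbourhood T" using x by (auto simp: Z_def)
        then obtain t p where "T \<le> t" "p \<in> points t" "dist p x < target_radius t powr s"
          by (auto simp: neighbourhood_def)
        then show ?thesis using True target_radius_pos[of t]
          by (intro exI[of _ t] conjI bexI[of _ p]) (auto simp: dist_real_def)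
      qed
      then show "x \<in> W_adic D i j \<psi>" using x by (intro limsup_subset_W) auto
    qed
    then have "emeasure lebesgue ({0..<1} - Z) \<le> hausdorff_measure 1 (W_adic D i j \<psi>)"
      using Z by (intro emeasure_le_hausdorff_measure_1) auto
    moreover have "emeasure lebesgue ({0..<1} - Z) = 1"
      using emeasure_Diff_null_set[OF Z, of "{0..<1}"] by simp
    ultimately have "1 \<le> hausdorff_measure 1 (W_adic D i j \<psi>)" by simp
    then show ?thesis using le hausdorff_measure_1_unit_interval_le True by (metis order_antisym order_trans)
  qed
qed

end

end

theorem theorem2:
  fixes i j s :: real and D :: "nat \<Rightarrow> nat" and \<psi> :: "nat \<Rightarrow> real"
  assumes "i > 0" and "j > 0" and "i + j = 1"
    and "adic_sequence D" and "bounded_ratios D"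
    and "s \<in> {i<..1}"
    and "\<And>q. q \<ge> 1 \<Longrightarrow> \<psi> q \<ge> 0"
    and "\<psi> \<longlonglongrightarrow> 0"
    and "antimono_on {1..} (f_psi i j s \<psi>)"
  shows "(summable (\<lambda>r. f_psi i j s \<psi> (Suc r)) \<longrightarrow>
            hausdorff_measure s (W_adic D i j \<psi>) = 0) \<and>
         (\<not> summable (\<lambda>r. f_psi i j s \<psi> (Suc r)) \<and>
          (mono_on {1..} \<psi> \<or> antimono_on {1..} \<psi>) \<longrightarrow>
            hausdorff_measure s (W_adic D i j \<psi>) = hausdorff_measure s {0..<1::real})"
proof -
  interpret adic_approximation i j s D \<psi>
    by unfold_locales (use assms in auto)
  show ?thesis using convergence divergence by blast
qed

end
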